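(* Consider a symmetric 2-receiver discrete memoryless broadcast channel with random state, $p(s)p(y_1,y_2|x,s)$, and let $R_{\mathrm{sym}}=\sup\{R:(R,R)\in\mathscr{R}\}$, where $\mathscr{R}$ is the Shayevitz--Wigger rate region for stale state information defined in the context. Then $$ \begin{aligned} R_{\mathrm{sym}}=\max\min\Big\{& I(U_1;Y_1,V_1|Q,U_0,S)+\tfrac12 I(U_0;Y_1,V_1|Q,S)-\tfrac12 I(U_1;U_2|Q,U_0)\\ &\quad-I(U_0,U_1,U_2;V_1|Q,V_0,Y_1,S)-\tfrac12 I(U_0,U_1,U_2;V_0|Q,Y_1,S),\\ & I(U_0,U_1;Y_1,V_1|Q,S)-\tfrac12 I(U_1;U_2|Q,U_0)-I(U_0,U_1,U_2;V_0,V_1|Q,Y_1,S)\Big\}, \end{aligned} $$ where the maximization is over all symmetric auxiliary random variables $(U_0,U_1,U_2,V_0,V_1,V_2,Q)$ and functions $X=x(U_0,U_1,U_2,Q)$ (symmetric in the sense defined in the context), with joint pmf of the form given in the context.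
   Context: All alphabets are finite. A 2-receiver discrete memoryless broadcast channel (DM-BC) with random state consists of an input alphabet $\mathcal X$, output alphabets $\mathcal Y_1,\mathcal Y_2$, a state $S\sim p(s)$ on $\mathcal S$, and a conditional pmf $p(y_1,y_2|x,s)$. It is called symmetric if $\mathcal Y_1=\mathcal Y_2=\mathcal Y$, $\mathcal S=\{1,\dots,|\mathcal S|\}$, and there is a bijection $\pi:\mathcal S\to\mathcal S$ such that $p_S(s)=p_S(\pi(s))$ and $p_{Y_1|X,S}(y|x,s)=p_{Y_2|X,S}(y|x,\pi(s))$ for all $x,y,s$. Auxiliary random variables: a choice of auxiliaries is a tuple of finite-alphabet random variables $(U_0,U_1,U_2,V_0,V_1,V_2,Q)$ and a function $x(u_0,u_1,u_2,q)$ such that the joint pmf of all variables is $$p(q)\,p(u_0,u_1,u_2|q)\,\mathbf 1_{x=x(u_0,u_1,u_2,q)}\,p(s)\,p(y_1,y_2|x,s)\,p(v_0,v_1,v_2|u_0,u_1,u_2,s,q).$$ The region $\mathscr{R}$ (achievable by the Shayevitz--Wigger scheme when the state is known at both decoders and strictly causally at the encoder) is the set of nonnegative pairs $(R_1,R_2)$ such that, for some choice of auxiliaries, $$ \begin{aligned} R_1 \le{}& I(U_0,U_1;Y_1,V_1|Q,S)-I(U_0,U_1,U_2;V_0,V_1|Q,Y_1,S),\\ R_2 \le{}& I(U_0,U_2;Y_2,V_2|Q,S)-I(U_0,U_1,U_2;V_0,V_2|Q,Y_2,S),\\ R_1+R_2 \le{}& I(U_1;Y_1,V_1|Q,U_0,S)+I(U_2;Y_2,V_2|Q,U_0,S)+\min_{i\in\{1,2\}}I(U_0;Y_i,V_i|Q,S)\\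 &-I(U_1;U_2|Q,U_0)-I(U_0,U_1,U_2;V_1|Q,V_0,Y_1,S)-I(U_0,U_1,U_2;V_2|Q,V_0,Y_2,S)\\ &-\max_{i\in\{1,2\}}I(U_0,U_1,U_2;V_0|Q,Y_i,S),\\ R_1+R_2 \le{}& I(U_0,U_1;Y_1,V_1|Q,S)+I(U_0,U_2;Y_2,V_2|Q,S)-I(U_1;U_2|Q,U_0)\\ &-I(U_0,U_1,U_2;V_0,V_1|Q,Y_1,S)-I(U_0,U_1,U_2;V_0,V_2|Q,Y_2,S). \end{aligned} $$ Symmetric auxiliaries: assume (without loss of generality) that $U_1,U_2$ have a common alphabet $\mathcal U$ and $V_1,V_2$ have a common alphabet $\mathcal V$. A choice of auxiliaries and function is symmetric (for the symmetric channel with bijection $\pi$) if $\mathcal Q=\{1,\dots,|\mathcal Q|\}$ and there is a bijection $\tilde\pi:\mathcal Q\to\mathcal Q$ such that for all arguments $$ \begin{aligned} p_Q(q)&=p_Q(\tilde\pi(q)),\\ p(u_0,u_1,u_2|q)&=p(u_0,u_2,u_1|\tilde\pi(q)),\\ x(u_0,u_1,u_2,q)&=x(u_0,u_2,u_1,\tilde\pi(q)),\\ p(v_0,v_1,v_2|u_0,u_1,u_2,q,s)&=p(v_0,v_2,v_1|u_0,u_2,u_1,\tilde\pi(q),\pi(s)). \end{aligned} $$ Here the maximum over auxiliaries is understood as a supremum, consistently with the definition of $R_{\mathrm{sym}}$ as a supremum.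
   Formalization: The formal theorem additionally assumes p_{Y2|X,S}(y|x,s)=p_{Y1|X,S}(y|x,π(s)), automatic when π is an involution; for a general bijection π (e.g. a 3-cycle on three states) the stated formula can fail. *)

theory Defs
  imports "HOL-Probability.Probability"
begin

(* Conditional mutual information, in bits, of functions on a probability space given by a pmf.
   It is used for random variables with finitely many values in countable types, where products
   of the discrete sigma-algebras are again discrete. *)
definition cond_mi :: "'o pmf \<Rightarrow> ('o \<Rightarrow> 'a) \<Rightarrow> ('o \<Rightarrow> 'b) \<Rightarrow> ('o \<Rightarrow> 'c) \<Rightarrow> real"
    (\<open>\<I>[_]'(_; _ | _')\<close> [0, 51, 51, 51] 1000)
  where "\<I>[P](A; B | C) =
    prob_space.conditional_mutual_information (measure_pmf P) 2
      (count_space UNIV) (count_space UNIV) (count_space UNIV) A B C"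

definition joint_rv :: "('o \<Rightarrow> 'a) \<Rightarrow> ('o \<Rightarrow> 'b) \<Rightarrow> 'o \<Rightarrow> 'a \<times> 'b" (infixr \<open>\<triangle>\<close> 60)
  where "A \<triangle> B = (\<lambda>\<omega>. (A \<omega>, B \<omega>))"

(* A broadcast channel with random state is given by the pmf pS of the state and the
   kernel W, where W x s is the conditional pmf of (y1, y2) given (x, s).
   The channel alphabets are finite types. *)

(* The auxiliary alphabets are finite sets of natural numbers, since a choice of auxiliaries
   is quantified over inside the statement. The kernels and x_fun matter on the alphabets only. *)
record ('x, 's) aux =
  alph_Q :: "nat set"
  alph_U0 :: "nat set"
  alph_U1 :: "nat set"
  alph_U2 :: "nat set"
  alph_V0 :: "nat set"
  alph_V1 :: "nat set"
  alph_V2 :: "nat set"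
  p_Q :: "nat pmf"
  p_U :: "nat \<Rightarrow> (nat \<times> nat \<times> nat) pmf"
  x_fun :: "nat \<Rightarrow> nat \<Rightarrow> nat \<Rightarrow> nat \<Rightarrow> 'x"
  p_V :: "nat \<times> nat \<times> nat \<Rightarrow> 's \<Rightarrow> nat \<Rightarrow> (nat \<times> nat \<times> nat) pmf"

definition is_aux :: "('x, 's) aux \<Rightarrow> bool" where
  "is_aux a \<longleftrightarrow>
     finite (alph_Q a) \<and>
     finite (alph_U0 a) \<and> finite (alph_U1 a) \<and> finite (alph_U2 a) \<and>
     finite (alph_V0 a) \<and> finite (alph_V1 a) \<and> finite (alph_V2 a) \<and>
     set_pmf (p_Q a) \<subseteq> alph_Q a \<and>
     (\<forall>q\<in>alph_Q a. set_pmf (p_U a q) \<subseteq> alph_U0 a \<times> alph_U1 a \<times> alph_U2 a) \<and>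
     (\<forall>u\<in>alph_U0 a \<times> alph_U1 a \<times> alph_U2 a. \<forall>s. \<forall>q\<in>alph_Q a.
        set_pmf (p_V a u s q) \<subseteq> alph_V0 a \<times> alph_V1 a \<times> alph_V2 a)"

datatype ('x, 's, 'y1, 'y2) outcome =
  Outcome (Qrv: nat) (U0: nat) (U1: nat) (U2: nat) (Xrv: 'x) (Srv: 's) (Y1: 'y1) (Y2: 'y2)
    (V0: nat) (V1: nat) (V2: nat)

definition joint_pmf ::
    "'s pmf \<Rightarrow> ('x \<Rightarrow> 's \<Rightarrow> ('y1 \<times> 'y2) pmf) \<Rightarrow> ('x, 's) aux \<Rightarrow> ('x, 's, 'y1, 'y2) outcome pmf"
  where "joint_pmf pS W a =
    do { q \<leftarrow> p_Q a;
         (u0, u1, u2) \<leftarrow> p_U a q;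
         let x = x_fun a u0 u1 u2 q;
         s \<leftarrow> pS;
         (y1, y2) \<leftarrow> W x s;
         (v0, v1, v2) \<leftarrow> p_V a (u0, u1, u2) s q;
         return_pmf (Outcome q u0 u1 u2 x s y1 y2 v0 v1 v2) }"

definition in_region_for ::
    "('x, 's, 'y1, 'y2) outcome pmf \<Rightarrow> real \<Rightarrow> real \<Rightarrow> bool"
  where "in_region_for P R1 R2 \<longleftrightarrow>
    R1 \<le> \<I>[P](U0 \<triangle> U1; Y1 \<triangle> V1 | Qrv \<triangle> Srv) - \<I>[P](U0 \<triangle> U1 \<triangle> U2; V0 \<triangle> V1 | Qrv \<triangle> Y1 \<triangle> Srv) \<and>
    R2 \<le> \<I>[P](U0 \<triangle> U2; Y2 \<triangle> V2 | Qrv \<triangle> Srv) - \<I>[P](U0 \<triangle> U1 \<triangle> U2; V0 \<triangle> V2 | Qrv \<triangle> Y2 \<triangle> Srv) \<and>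
    R1 + R2 \<le>
      \<I>[P](U1; Y1 \<triangle> V1 | Qrv \<triangle> U0 \<triangle> Srv) + \<I>[P](U2; Y2 \<triangle> V2 | Qrv \<triangle> U0 \<triangle> Srv)
      + min (\<I>[P](U0; Y1 \<triangle> V1 | Qrv \<triangle> Srv)) (\<I>[P](U0; Y2 \<triangle> V2 | Qrv \<triangle> Srv))
      - \<I>[P](U1; U2 | Qrv \<triangle> U0)
      - \<I>[P](U0 \<triangle> U1 \<triangle> U2; V1 | Qrv \<triangle> V0 \<triangle> Y1 \<triangle> Srv)
      - \<I>[P](U0 \<triangle> U1 \<triangle> U2; V2 | Qrv \<triangle> V0 \<triangle> Y2 \<triangle> Srv)
      - max (\<I>[P](U0 \<triangle> U1 \<triangle> U2; V0 | Qrv \<triangle> Y1 \<triangle> Srv)) (\<I>[P](U0 \<triangle> U1 \<triangle> U2; V0 | Qrv \<triangle> Y2 \<triangle> Srv)) \<and>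
    R1 + R2 \<le>
      \<I>[P](U0 \<triangle> U1; Y1 \<triangle> V1 | Qrv \<triangle> Srv) + \<I>[P](U0 \<triangle> U2; Y2 \<triangle> V2 | Qrv \<triangle> Srv)
      - \<I>[P](U1; U2 | Qrv \<triangle> U0)
      - \<I>[P](U0 \<triangle> U1 \<triangle> U2; V0 \<triangle> V1 | Qrv \<triangle> Y1 \<triangle> Srv)
      - \<I>[P](U0 \<triangle> U1 \<triangle> U2; V0 \<triangle> V2 | Qrv \<triangle> Y2 \<triangle> Srv)"

definition SW_region ::
    "'s::finite pmf \<Rightarrow> ('x::finite \<Rightarrow> 's \<Rightarrow> ('y1::finite \<times> 'y2::finite) pmf) \<Rightarrow> (real \<times> real) set"
  where "SW_region pS W =
    {(R1, R2). 0 \<le> R1 \<and> 0 \<le> R2 \<and> (\<exists>a. is_aux a \<and> in_region_for (joint_pmf pS W a) R1 R2)}"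

definition R_sym ::
    "'s::finite pmf \<Rightarrow> ('x::finite \<Rightarrow> 's \<Rightarrow> ('y1::finite \<times> 'y2::finite) pmf) \<Rightarrow> ereal"
  where "R_sym pS W = Sup {ereal R | R. (R, R) \<in> SW_region pS W}"

(* Nothing here forces \<pi> to be an involution, so the reverse exchange, from Y2 in state s to
   Y1 in state \<pi> s, is not a consequence: a 3-cycle is possible. *)
definition symmetric_channel ::
    "'s::finite pmf \<Rightarrow> ('x::finite \<Rightarrow> 's \<Rightarrow> ('y::finite \<times> 'y) pmf) \<Rightarrow> ('s \<Rightarrow> 's) \<Rightarrow> bool"
  where "symmetric_channel pS W \<pi> \<longleftrightarrow>
    bij \<pi> \<and>
    (\<forall>s. pmf pS s = pmf pS (\<pi> s)) \<and>
    (\<forall>x s y. pmf (map_pmf fst (W x s)) y = pmf (map_pmf snd (W x (\<pi> s))) y)"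

definition symmetric_aux :: "('s \<Rightarrow> 's) \<Rightarrow> ('x, 's) aux \<Rightarrow> bool" where
  "symmetric_aux \<pi> a \<longleftrightarrow>
     alph_U1 a = alph_U2 a \<and> alph_V1 a = alph_V2 a \<and>
     (\<exists>m. alph_Q a = {1..m}) \<and>
     (\<exists>\<pi>'. bij_betw \<pi>' (alph_Q a) (alph_Q a) \<and>
       (\<forall>q\<in>alph_Q a.
          pmf (p_Q a) q = pmf (p_Q a) (\<pi>' q) \<and>
          (\<forall>u0\<in>alph_U0 a. \<forall>u1\<in>alph_U1 a. \<forall>u2\<in>alph_U2 a.
             pmf (p_U a q) (u0, u1, u2) = pmf (p_U a (\<pi>' q)) (u0, u2, u1) \<and>
             x_fun a u0 u1 u2 q = x_fun a u0 u2 u1 (\<pi>' q) \<and>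
             (\<forall>s. \<forall>v0\<in>alph_V0 a. \<forall>v1\<in>alph_V1 a. \<forall>v2\<in>alph_V2 a.
                pmf (p_V a (u0, u1, u2) s q) (v0, v1, v2) =
                pmf (p_V a (u0, u2, u1) (\<pi> s) (\<pi>' q)) (v0, v2, v1)))))"

definition sym_objective :: "('x, 's, 'y1, 'y2) outcome pmf \<Rightarrow> real" where
  "sym_objective P =
    min (\<I>[P](U1; Y1 \<triangle> V1 | Qrv \<triangle> U0 \<triangle> Srv) + 1/2 * \<I>[P](U0; Y1 \<triangle> V1 | Qrv \<triangle> Srv)
           - 1/2 * \<I>[P](U1; U2 | Qrv \<triangle> U0)
           - \<I>[P](U0 \<triangle> U1 \<triangle> U2; V1 | Qrv \<triangle> V0 \<triangle> Y1 \<triangle> Srv)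
           - 1/2 * \<I>[P](U0 \<triangle> U1 \<triangle> U2; V0 | Qrv \<triangle> Y1 \<triangle> Srv))
        (\<I>[P](U0 \<triangle> U1; Y1 \<triangle> V1 | Qrv \<triangle> Srv) - 1/2 * \<I>[P](U1; U2 | Qrv \<triangle> U0)
           - \<I>[P](U0 \<triangle> U1 \<triangle> U2; V0 \<triangle> V1 | Qrv \<triangle> Y1 \<triangle> Srv))"

end

(* For a symmetric choice of auxiliaries, exchanging the receivers is a relabelling of (Q, S), so
   the information quantities of the two receivers agree and all bounds of the region on (R, R)
   reduce to the two terms of the objective, since I(U1; U2 | Q, U0) is nonnegative. A negative
   objective is covered by constant auxiliaries.

   Conversely, arbitrary auxiliaries are symmetrized by time sharing. A fair coin in Q deciding
   whether to exchange the receivers would suffice if \<pi> were an involution. In general Q is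
   extended by a uniform j modulo 2n, where \<pi>^n = id; the kernels for j are obtained by
   exchanging the receivers j times, each time applying the inverse of \<pi> to the state seen by
   the kernel of V. By the mutual symmetry of the channel every information quantity becomes the
   mean of those of the two receivers, and min and max only help. *)

theory Submission
  imports Defs "HOL-Combinatorics.Cycles"
begin

section \<open>Conditional mutual information and entropy\<close>

text \<open>Shannon entropy in bits, written as an expectation over \<open>P\<close> itself rather
  than as a sum over values of \<open>X\<close>. Changing the variable or mixing laws then becomes a
  congruence of integrals on the support of \<open>P\<close>.\<close>

definition ent :: "'o pmf \<Rightarrow> ('o \<Rightarrow> 'a) \<Rightarrow> real" where
  "ent P X = - measure_pmf.expectation P (\<lambda>\<omega>. log 2 (pmf (map_pmf X P) (X \<omega>)))"

lemma pmf_map_at_pos: "\<omega> \<in> set_pmf P \<Longrightarrow> 0 < pmf (map_pmf X P) (X \<omega>)"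
  by (simp add: pmf_positive)

lemma distributed_map_pmf:
  "distributed (measure_pmf P) (count_space UNIV) X (\<lambda>x. ennreal (pmf (map_pmf X P) x))"
  unfolding distributed_def measure_pmf_eq_density[symmetric] map_pmf_rep_eq by simp

lemma count_space_pair_UNIV:
  "count_space (UNIV :: 'a::countable set) \<Otimes>\<^sub>M count_space (UNIV :: 'b::countable set) = count_space UNIV"
  by (simp add: pair_measure_countable)

lemma information_space_measure_pmf: "information_space (measure_pmf P) 2"
  by (intro information_space.intro information_space_axioms.intro)
    (simp_all add: measure_pmf.prob_space_axioms)

text \<open>On the support all three probabilities are positive, so the logarithm of the quotient
  splits into three; finite support makes each part integrable.\<close>

lemma mutual_information_eq_ent:
  fixes X :: "'o \<Rightarrow> 'a::countable" and Y :: "'o \<Rightarrow> 'b::countable"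
  assumes fin: "finite (set_pmf P)"
  shows "prob_space.mutual_information (measure_pmf P) 2 (count_space UNIV) (count_space UNIV) X Y =
    ent P X + ent P Y - ent P (X \<triangle> Y)"
proof -
  interpret information_space "measure_pmf P" 2 by (rule information_space_measure_pmf)
  let ?pX = "pmf (map_pmf X P)" and ?pY = "pmf (map_pmf Y P)" and ?XY = "\<lambda>\<omega>. (X \<omega>, Y \<omega>)"
  let ?pXY = "pmf (map_pmf ?XY P)"
  have "prob_space.mutual_information (measure_pmf P) 2 (count_space UNIV) (count_space UNIV) X Y =
      integral\<^sup>L (count_space UNIV \<Otimes>\<^sub>M count_space UNIV)
        (\<lambda>z. ?pXY z * log 2 (?pXY z / (?pX (fst z) * ?pY (snd z))))"
    by (rule mutual_information_distr)
      (simp_all add: sigma_finite_measure_count_space count_space_pair_UNIV distributed_map_pmf)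
  also have "\<dots> = measure_pmf.expectation (map_pmf ?XY P) (\<lambda>z. log 2 (?pXY z / (?pX (fst z) * ?pY (snd z))))"
    unfolding count_space_pair_UNIV
    by (subst measure_pmf_eq_density) (simp add: integral_density)
  also have "\<dots> = measure_pmf.expectation P (\<lambda>\<omega>. log 2 (?pXY (?XY \<omega>) / (?pX (X \<omega>) * ?pY (Y \<omega>))))"
    by simp
  also have "\<dots> = measure_pmf.expectation P
      (\<lambda>\<omega>. log 2 (?pXY (?XY \<omega>)) - log 2 (?pX (X \<omega>)) - log 2 (?pY (Y \<omega>)))"
  proof (intro integral_cong_AE)
    show "AE \<omega> in P. log 2 (?pXY (?XY \<omega>) / (?pX (X \<omega>) * ?pY (Y \<omega>))) =
        log 2 (?pXY (?XY \<omega>)) - log 2 (?pX (X \<omega>)) - log 2 (?pY (Y \<omega>))"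
    proof (rule AE_pmfI)
      fix \<omega> assume "\<omega> \<in> set_pmf P"
      then have "0 < ?pXY (?XY \<omega>)" "0 < ?pX (X \<omega>)" "0 < ?pY (Y \<omega>)"
        by (rule pmf_map_at_pos)+
      then show "log 2 (?pXY (?XY \<omega>) / (?pX (X \<omega>) * ?pY (Y \<omega>))) =
          log 2 (?pXY (?XY \<omega>)) - log 2 (?pX (X \<omega>)) - log 2 (?pY (Y \<omega>))"
        by (simp add: log_divide_pos log_mult_pos)
    qed
  qed simp_all
  also have "\<dots> = ent P X + ent P Y - ent P (X \<triangle> Y)"
    unfolding ent_def joint_rv_def
    by (simp add: integrable_measure_pmf_finite[OF fin])
  finally show ?thesis .
qed

text \<open>Conditional mutual information is by definition I(A; (B, C)) - I(A; C); the entropy of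
  \<open>A\<close> alone cancels.\<close>

lemma cond_mi_eq_ent:
  fixes A :: "'o \<Rightarrow> 'a::countable" and B :: "'o \<Rightarrow> 'b::countable" and C :: "'o \<Rightarrow> 'c::countable"
  assumes fin: "finite (set_pmf P)"
  shows "\<I>[P](A; B | C) = ent P (A \<triangle> C) + ent P (B \<triangle> C) - ent P (A \<triangle> B \<triangle> C) - ent P C"
proof -
  interpret information_space "measure_pmf P" 2 by (rule information_space_measure_pmf)
  have BC: "(\<lambda>x. (B x, C x)) = B \<triangle> C"
    by (simp add: joint_rv_def)
  show ?thesis
    unfolding cond_mi_def prob_space.conditional_mutual_information_def[OF measure_pmf.prob_space_axioms]
      count_space_pair_UNIV BC
    by (simp add: mutual_information_eq_ent[OF fin])
qed

lemma cond_mi_nonneg: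
  fixes A :: "'o \<Rightarrow> 'a::countable" and B :: "'o \<Rightarrow> 'b::countable" and C :: "'o \<Rightarrow> 'c::countable"
  assumes fin: "finite (set_pmf P)"
  shows "0 \<le> \<I>[P](A; B | C)"
proof -
  interpret information_space "measure_pmf P" 2 by (rule information_space_measure_pmf)
  \<comment> \<open>These are the integrability conditions of the general nonnegativity theorem;
    they hold because \<open>P\<close> has finite support.\<close>
  have int: "integrable (count_space UNIV) (\<lambda>z. pmf (map_pmf f P) z * g z)" 
    for f :: "'o \<Rightarrow> 'a \<times> 'b \<times> 'c" and g :: "'a \<times> 'b \<times> 'c \<Rightarrow> real"
  proof -
    have "integrable (map_pmf f P) g"
      by (rule integrable_measure_pmf_finite) (simp add: fin)
    then show ?thesis
      by (subst (asm) measure_pmf_eq_density) (simp add: integrable_density)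
  qed
  show ?thesis
    unfolding cond_mi_def
    by (rule conditional_mutual_information_generic_nonneg[
        where Px = "pmf (map_pmf A P)" and Pz = "pmf (map_pmf C P)"
          and Pyz = "pmf (map_pmf (\<lambda>x. (B x, C x)) P)" and Pxz = "pmf (map_pmf (\<lambda>x. (A x, C x)) P)"
          and Pxyz = "pmf (map_pmf (\<lambda>x. (A x, B x, C x)) P)"])
      (simp_all add: sigma_finite_measure_count_space count_space_pair_UNIV distributed_map_pmf
         split_def int)
qed

text \<open>Entropy depends only on the partition of the support into level sets of the variable,
  not on the values. Every relabelling argument below rests on this.\<close>

lemma ent_cong:
  assumes "\<And>\<omega> \<omega>'. \<omega> \<in> set_pmf P \<Longrightarrow> \<omega>' \<in> set_pmf P \<Longrightarrow> Y (f \<omega>) = Y (f \<omega>') \<longleftrightarrow> X \<omega> = X \<omega>'"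
  shows "ent (map_pmf f P) Y = ent P X"
proof -
  have "pmf (map_pmf Y (map_pmf f P)) (Y (f \<omega>)) = pmf (map_pmf X P) (X \<omega>)" if "\<omega> \<in> set_pmf P" for \<omega>
    unfolding map_pmf_comp pmf_map
    by (rule measure_pmf.finite_measure_eq_AE) (use assms that in \<open>auto intro!: AE_pmfI\<close>)
  then show ?thesis
    unfolding ent_def by (auto intro!: integral_cong_AE AE_pmfI)
qed

lemma cond_mi_cong:
  fixes A :: "'o \<Rightarrow> 'a::countable" and B :: "'o \<Rightarrow> 'b::countable" and C :: "'o \<Rightarrow> 'c::countable"
    and A' :: "'p \<Rightarrow> 'd::countable" and B' :: "'p \<Rightarrow> 'e::countable" and C' :: "'p \<Rightarrow> 'f::countable"
  assumes fin: "finite (set_pmf P)"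
    and "\<And>\<omega> \<omega>'. \<omega> \<in> set_pmf P \<Longrightarrow> \<omega>' \<in> set_pmf P \<Longrightarrow> A' (f \<omega>) = A' (f \<omega>') \<longleftrightarrow> A \<omega> = A \<omega>'"
    and "\<And>\<omega> \<omega>'. \<omega> \<in> set_pmf P \<Longrightarrow> \<omega>' \<in> set_pmf P \<Longrightarrow> B' (f \<omega>) = B' (f \<omega>') \<longleftrightarrow> B \<omega> = B \<omega>'"
    and "\<And>\<omega> \<omega>'. \<omega> \<in> set_pmf P \<Longrightarrow> \<omega>' \<in> set_pmf P \<Longrightarrow> C' (f \<omega>) = C' (f \<omega>') \<longleftrightarrow> C \<omega> = C \<omega>'"
  shows "\<I>[map_pmf f P](A'; B' | C') = \<I>[P](A; B | C)"
proof -
  have fin': "finite (set_pmf (map_pmf f P))"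
    using fin by simp
  show ?thesis
    unfolding cond_mi_eq_ent[OF fin] cond_mi_eq_ent[OF fin']
    using assms by (intro arg_cong2[where f = minus] arg_cong2[where f = plus] ent_cong) (auto simp: joint_rv_def)
qed

lemma cond_mi_commute:
  fixes A :: "'o \<Rightarrow> 'a::countable" and B :: "'o \<Rightarrow> 'b::countable" and C :: "'o \<Rightarrow> 'c::countable"
  assumes fin: "finite (set_pmf P)"
  shows "\<I>[P](A; B | C) = \<I>[P](B; A | C)"
proof -
  have "ent P (A \<triangle> B \<triangle> C) = ent P (B \<triangle> A \<triangle> C)"
    using ent_cong[of P "A \<triangle> B \<triangle> C" id "B \<triangle> A \<triangle> C"] by (auto simp: joint_rv_def)
  then show ?thesis
    by (simp add: cond_mi_eq_ent[OF fin])
qed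

lemma cond_mi_const:
  fixes A :: "'o \<Rightarrow> 'a::countable" and B :: "'o \<Rightarrow> 'b::countable" and C :: "'o \<Rightarrow> 'c::countable"
  assumes fin: "finite (set_pmf P)" and const: "\<And>\<omega>. \<omega> \<in> set_pmf P \<Longrightarrow> A \<omega> = c"
  shows "\<I>[P](A; B | C) = 0"
proof -
  have "ent P (A \<triangle> C) = ent P C" "ent P (A \<triangle> B \<triangle> C) = ent P (B \<triangle> C)"
    using ent_cong[of P "A \<triangle> C" id C] ent_cong[of P "A \<triangle> B \<triangle> C" id "B \<triangle> C"] const
    by (auto simp: joint_rv_def)
  then show ?thesis
    by (simp add: cond_mi_eq_ent[OF fin])
qed

text \<open>When \<open>X\<close> reveals the component, the laws of \<open>X\<close> under the
  \<open>E j\<close> have disjoint supports. The uniform choice of \<open>j\<close> then contributes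
  log |J| bits on top of the mean entropy.\<close>

lemma ent_uniform_mixture:
  assumes J: "finite J" "J \<noteq> {}"
    and fin: "\<And>j. j \<in> J \<Longrightarrow> finite (set_pmf (E j))"
    and sep: "\<And>i j \<omega> \<omega>'. i \<in> J \<Longrightarrow> j \<in> J \<Longrightarrow> \<omega> \<in> set_pmf (E i) \<Longrightarrow> \<omega>' \<in> set_pmf (E j) \<Longrightarrow>
      X \<omega> = X \<omega>' \<Longrightarrow> i = j"
  shows "ent (pmf_of_set J \<bind> E) X = log 2 (card J) + (\<Sum>j\<in>J. ent (E j) X) / card J"
proof -
  let ?D = "pmf_of_set J \<bind> E"
  have card: "0 < card J" using J by (simp add: card_gt_0_iff)
  \<comment> \<open>A value reached in component \<open>j\<close> has mass zero in all others, so
    only the share of \<open>j\<close> with weight 1/|J| remains.\<close>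
  have pD: "pmf (map_pmf X ?D) (X \<omega>) = pmf (map_pmf X (E j)) (X \<omega>) / card J"
    if "j \<in> J" "\<omega> \<in> set_pmf (E j)" for j \<omega>
  proof -
    have zero: "pmf (map_pmf X (E i)) (X \<omega>) = 0" if "i \<in> J" "i \<noteq> j" for i
      using sep[OF \<open>i \<in> J\<close> \<open>j \<in> J\<close> _ \<open>\<omega> \<in> set_pmf (E j)\<close>] \<open>i \<noteq> j\<close>
        by (force simp: set_pmf_iff[symmetric] pmf_eq_0_set_pmf)
    have "(\<Sum>i\<in>J. pmf (map_pmf X (E i)) (X \<omega>)) = (\<Sum>i\<in>{j}. pmf (map_pmf X (E i)) (X \<omega>))"
      by (rule sum.mono_neutral_right) (use J zero that in auto)
    then show ?thesis
      by (simp add: map_bind_pmf pmf_bind_pmf_of_set J)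
  qed
  have E: "measure_pmf.expectation (E j) (\<lambda>\<omega>. log 2 (pmf (map_pmf X ?D) (X \<omega>))) =
      - ent (E j) X - log 2 (card J)" if j: "j \<in> J" for j
  proof -
    have "measure_pmf.expectation (E j) (\<lambda>\<omega>. log 2 (pmf (map_pmf X ?D) (X \<omega>))) =
        measure_pmf.expectation (E j) (\<lambda>\<omega>. log 2 (pmf (map_pmf X (E j)) (X \<omega>)) - log 2 (card J))"
    proof (intro integral_cong_AE AE_pmfI)
      fix \<omega> assume \<omega>: "\<omega> \<in> set_pmf (E j)"
      show "log 2 (pmf (map_pmf X ?D) (X \<omega>)) = log 2 (pmf (map_pmf X (E j)) (X \<omega>)) - log 2 (card J)"
        using pmf_map_at_pos[OF \<omega>, of X] card by (simp add: pD[OF j \<omega>] log_divide_pos)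
    qed simp_all
    then show ?thesis
      by (simp add: ent_def integrable_measure_pmf_finite[OF fin[OF j]])
  qed
  have "ent ?D X = - (\<Sum>j\<in>J. measure_pmf.expectation (E j) (\<lambda>\<omega>. log 2 (pmf (map_pmf X ?D) (X \<omega>))) /\<^sub>R card J)"
    unfolding ent_def by (subst (1) pmf_expectation_bind_pmf_of_set) (use J fin in auto)
  also have "\<dots> = - (\<Sum>j\<in>J. (- ent (E j) X - log 2 (card J)) /\<^sub>R card J)"
    by (simp add: E)
  also have "\<dots> = log 2 (card J) + (\<Sum>j\<in>J. ent (E j) X) / card J"
    using card by (simp add: sum_subtractf sum_negf sum_distrib_left[symmetric]
        sum_divide_distrib[symmetric] field_simps)
  finally show ?thesis .
qed

text \<open>All four joint variables contain \<open>C\<close> and hence reveal the component. Each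
  entropy gains the same log |J|; two enter with plus and two with minus, so these gains cancel and
  the means remain.\<close>

lemma cond_mi_uniform_mixture:
  fixes A :: "'o \<Rightarrow> 'a::countable" and B :: "'o \<Rightarrow> 'b::countable" and C :: "'o \<Rightarrow> 'c::countable"
  assumes J: "finite J" "J \<noteq> {}"
    and fin: "\<And>j. j \<in> J \<Longrightarrow> finite (set_pmf (E j))"
    and sep: "\<And>i j \<omega> \<omega>'. i \<in> J \<Longrightarrow> j \<in> J \<Longrightarrow> \<omega> \<in> set_pmf (E i) \<Longrightarrow> \<omega>' \<in> set_pmf (E j) \<Longrightarrow>
      C \<omega> = C \<omega>' \<Longrightarrow> i = j"
  shows "\<I>[pmf_of_set J \<bind> E](A; B | C) = (\<Sum>j\<in>J. \<I>[E j](A; B | C)) / card J"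
proof -
  have ent: "ent (pmf_of_set J \<bind> E) X = log 2 (card J) + (\<Sum>j\<in>J. ent (E j) X) / card J"
    if "\<And>\<omega> \<omega>'. X \<omega> = X \<omega>' \<Longrightarrow> C \<omega> = C \<omega>'" for X :: "'o \<Rightarrow> 'z"
    by (rule ent_uniform_mixture[OF J fin]) (use sep that in blast)+
  have fin': "finite (set_pmf (pmf_of_set J \<bind> E))"
    using J fin by (simp add: set_pmf_of_set)
  have "\<I>[pmf_of_set J \<bind> E](A; B | C) = (\<Sum>j\<in>J. ent (E j) (A \<triangle> C)) / card J + (\<Sum>j\<in>J. ent (E j) (B \<triangle> C)) / card J
     - (\<Sum>j\<in>J. ent (E j) (A \<triangle> B \<triangle> C)) / card J - (\<Sum>j\<in>J. ent (E j) C) / card J"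
    unfolding cond_mi_eq_ent[OF fin'] by (subst ent; simp add: joint_rv_def)+
  also have "\<dots> = (\<Sum>j\<in>J. \<I>[E j](A; B | C)) / card J"
    by (simp add: cond_mi_eq_ent fin sum.distrib sum_subtractf add_divide_distrib diff_divide_distrib)
  finally show ?thesis .
qed

section \<open>The channel as seen by one receiver\<close>

text \<open>In both views the receiver's own variables are U1, V1, Y1; the other output is dropped.\<close>
type_synonym ('x, 's, 'y) view = "('x, 's, 'y, unit) outcome"

definition view1 :: "('x, 's, 'y1, 'y2) outcome \<Rightarrow> ('x, 's, 'y1) view" where
  "view1 \<omega> = Outcome (Qrv \<omega>) (U0 \<omega>) (U1 \<omega>) (U2 \<omega>) (Xrv \<omega>) (Srv \<omega>) (Y1 \<omega>) ()
     (V0 \<omega>) (V1 \<omega>) (V2 \<omega>)"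

definition view2 :: "('x, 's, 'y1, 'y2) outcome \<Rightarrow> ('x, 's, 'y2) view" where
  "view2 \<omega> = Outcome (Qrv \<omega>) (U0 \<omega>) (U2 \<omega>) (U1 \<omega>) (Xrv \<omega>) (Srv \<omega>) (Y2 \<omega>) ()
     (V0 \<omega>) (V2 \<omega>) (V1 \<omega>)"

definition relabel :: "(nat \<Rightarrow> nat) \<Rightarrow> ('s \<Rightarrow> 's) \<Rightarrow> ('x, 's, 'y1, 'y2) outcome \<Rightarrow> ('x, 's, 'y1, 'y2) outcome" where
  "relabel f g \<omega> = Outcome (f (Qrv \<omega>)) (U0 \<omega>) (U1 \<omega>) (U2 \<omega>) (Xrv \<omega>) (g (Srv \<omega>)) (Y1 \<omega>) (Y2 \<omega>)
     (V0 \<omega>) (V1 \<omega>) (V2 \<omega>)"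

lemma view_sel [simp]:
  "Qrv (view1 \<omega>) = Qrv \<omega>" "U0 (view1 \<omega>) = U0 \<omega>" "U1 (view1 \<omega>) = U1 \<omega>" "U2 (view1 \<omega>) = U2 \<omega>"
  "Xrv (view1 \<omega>) = Xrv \<omega>" "Srv (view1 \<omega>) = Srv \<omega>" "Y1 (view1 \<omega>) = Y1 \<omega>"
  "V0 (view1 \<omega>) = V0 \<omega>" "V1 (view1 \<omega>) = V1 \<omega>" "V2 (view1 \<omega>) = V2 \<omega>"
  "Qrv (view2 \<omega>) = Qrv \<omega>" "U0 (view2 \<omega>) = U0 \<omega>" "U1 (view2 \<omega>) = U2 \<omega>" "U2 (view2 \<omega>) = U1 \<omega>"
  "Xrv (view2 \<omega>) = Xrv \<omega>" "Srv (view2 \<omega>) = Srv \<omega>" "Y1 (view2 \<omega>) = Y2 \<omega>"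
  "V0 (view2 \<omega>) = V0 \<omega>" "V1 (view2 \<omega>) = V2 \<omega>" "V2 (view2 \<omega>) = V1 \<omega>"
  by (simp_all add: view1_def view2_def)

lemma relabel_sel [simp]:
  "Qrv (relabel f g \<omega>) = f (Qrv \<omega>)" "U0 (relabel f g \<omega>) = U0 \<omega>" "U1 (relabel f g \<omega>) = U1 \<omega>"
  "U2 (relabel f g \<omega>) = U2 \<omega>" "Xrv (relabel f g \<omega>) = Xrv \<omega>" "Srv (relabel f g \<omega>) = g (Srv \<omega>)"
  "Y1 (relabel f g \<omega>) = Y1 \<omega>" "Y2 (relabel f g \<omega>) = Y2 \<omega>"
  "V0 (relabel f g \<omega>) = V0 \<omega>" "V1 (relabel f g \<omega>) = V1 \<omega>" "V2 (relabel f g \<omega>) = V2 \<omega>"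
  by (simp_all add: relabel_def)

lemma view1_relabel: "view1 (relabel f g \<omega>) = relabel f g (view1 \<omega>)"
  by (simp add: view1_def relabel_def)

section \<open>The seven information quantities of one receiver\<close>

definition mi_U1 :: "('x, 's, 'y1, 'y2) outcome pmf \<Rightarrow> real" where
  "mi_U1 P = \<I>[P](U1; Y1 \<triangle> V1 | Qrv \<triangle> U0 \<triangle> Srv)"
definition mi_U0 :: "('x, 's, 'y1, 'y2) outcome pmf \<Rightarrow> real" where
  "mi_U0 P = \<I>[P](U0; Y1 \<triangle> V1 | Qrv \<triangle> Srv)"
definition mi_U01 :: "('x, 's, 'y1, 'y2) outcome pmf \<Rightarrow> real" where
  "mi_U01 P = \<I>[P](U0 \<triangle> U1; Y1 \<triangle> V1 | Qrv \<triangle> Srv)"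
definition mi_U12 :: "('x, 's, 'y1, 'y2) outcome pmf \<Rightarrow> real" where
  "mi_U12 P = \<I>[P](U1; U2 | Qrv \<triangle> U0)"
definition mi_V1 :: "('x, 's, 'y1, 'y2) outcome pmf \<Rightarrow> real" where
  "mi_V1 P = \<I>[P](U0 \<triangle> U1 \<triangle> U2; V1 | Qrv \<triangle> V0 \<triangle> Y1 \<triangle> Srv)"
definition mi_V0 :: "('x, 's, 'y1, 'y2) outcome pmf \<Rightarrow> real" where
  "mi_V0 P = \<I>[P](U0 \<triangle> U1 \<triangle> U2; V0 | Qrv \<triangle> Y1 \<triangle> Srv)"
definition mi_V01 :: "('x, 's, 'y1, 'y2) outcome pmf \<Rightarrow> real" where
  "mi_V01 P = \<I>[P](U0 \<triangle> U1 \<triangle> U2; V0 \<triangle> V1 | Qrv \<triangle> Y1 \<triangle> Srv)"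

lemmas mi_defs = mi_U1_def mi_U0_def mi_U01_def mi_U12_def mi_V1_def mi_V0_def mi_V01_def

text \<open>Collecting the functionals in a set allows invariance and averaging to be stated once
  for all of them.\<close>

definition mi_terms :: "(('x, 's, 'y1, 'y2) outcome pmf \<Rightarrow> real) set" where
  "mi_terms = {mi_U1, mi_U0, mi_U01, mi_U12, mi_V1, mi_V0, mi_V01}"

text \<open>The terms see Q and S only through equality of their values. For Q, injectivity on the
  values actually taken suffices.\<close>

lemma mi_terms_relabel:
  fixes P :: "('x, 's::finite, 'y1::finite, 'y2) outcome pmf"
  assumes T: "T \<in> mi_terms" and fin: "finite (set_pmf P)"
    and f: "inj_on f (Qrv ` set_pmf P)" and g: "inj g"
  shows "T (map_pmf (relabel f g) P) = T P"
proof -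
  have [simp]: "f (Qrv \<omega>) = f (Qrv \<omega>') \<longleftrightarrow> Qrv \<omega> = Qrv \<omega>'" if "\<omega> \<in> set_pmf P" "\<omega>' \<in> set_pmf P" for \<omega> \<omega>'
    using f that by (auto dest: inj_onD)
  have [simp]: "g s = g s' \<longleftrightarrow> s = s'" for s s'
    using g by (auto dest: injD)
  show ?thesis
    using T unfolding mi_terms_def
    by (elim insertE emptyE) (simp only: mi_defs; rule cond_mi_cong[OF fin]; simp add: joint_rv_def)+
qed

text \<open>All seven terms are conditioned on Q, so it is enough that Q reveals the
  component.\<close>

lemma mi_terms_mixture:
  fixes E :: "'j \<Rightarrow> ('x, 's::finite, 'y1::finite, 'y2) outcome pmf"
  assumes T: "T \<in> mi_terms" and J: "finite J" "J \<noteq> {}"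
    and fin: "\<And>j. j \<in> J \<Longrightarrow> finite (set_pmf (E j))"
    and sep: "\<And>i j \<omega> \<omega>'. i \<in> J \<Longrightarrow> j \<in> J \<Longrightarrow> \<omega> \<in> set_pmf (E i) \<Longrightarrow> \<omega>' \<in> set_pmf (E j) \<Longrightarrow>
      Qrv \<omega> = Qrv \<omega>' \<Longrightarrow> i = j"
  shows "T (pmf_of_set J \<bind> E) = (\<Sum>j\<in>J. T (E j)) / card J"
  using T unfolding mi_terms_def
  by (elim insertE emptyE) (simp only: mi_defs; rule cond_mi_uniform_mixture[OF J fin];
    auto simp: joint_rv_def intro: sep)+

lemma sym_objective_eq:
  "sym_objective P = min (mi_U1 P + mi_U0 P / 2 - mi_U12 P / 2 - mi_V1 P - mi_V0 P / 2)
     (mi_U01 P - mi_U12 P / 2 - mi_V01 P)"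
  by (simp add: sym_objective_def mi_defs)

section \<open>The rate region expressed through the two views\<close>

context
  fixes P :: "('x, 's::finite, 'y1::finite, 'y2::finite) outcome pmf"
  assumes fin: "finite (set_pmf P)"
begin

lemma mi_view1:
  "mi_U1 (map_pmf view1 P) = mi_U1 P"
  "mi_U0 (map_pmf view1 P) = mi_U0 P"
  "mi_U01 (map_pmf view1 P) = mi_U01 P"
  "mi_U12 (map_pmf view1 P) = mi_U12 P"
  "mi_V1 (map_pmf view1 P) = mi_V1 P"
  "mi_V0 (map_pmf view1 P) = mi_V0 P"
  "mi_V01 (map_pmf view1 P) = mi_V01 P"
  by (simp only: mi_defs; rule cond_mi_cong[OF fin]; simp add: joint_rv_def)+

text \<open>\<open>view2\<close> puts the variables of receiver 2 in the places of receiver 1. It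
  also permutes the triple of U variables, which leaves its level sets unchanged.\<close>

lemma mi_view2:
  "mi_U1 (map_pmf view2 P) = \<I>[P](U2; Y2 \<triangle> V2 | Qrv \<triangle> U0 \<triangle> Srv)"
  "mi_U0 (map_pmf view2 P) = \<I>[P](U0; Y2 \<triangle> V2 | Qrv \<triangle> Srv)"
  "mi_U01 (map_pmf view2 P) = \<I>[P](U0 \<triangle> U2; Y2 \<triangle> V2 | Qrv \<triangle> Srv)"
  "mi_V1 (map_pmf view2 P) = \<I>[P](U0 \<triangle> U1 \<triangle> U2; V2 | Qrv \<triangle> V0 \<triangle> Y2 \<triangle> Srv)"
  "mi_V0 (map_pmf view2 P) = \<I>[P](U0 \<triangle> U1 \<triangle> U2; V0 | Qrv \<triangle> Y2 \<triangle> Srv)"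
  "mi_V01 (map_pmf view2 P) = \<I>[P](U0 \<triangle> U1 \<triangle> U2; V0 \<triangle> V2 | Qrv \<triangle> Y2 \<triangle> Srv)"
  by (simp only: mi_defs; rule cond_mi_cong[OF fin]; auto simp: joint_rv_def)+

lemma mi_U12_view2: "mi_U12 (map_pmf view2 P) = mi_U12 P"
proof -
  have "mi_U12 (map_pmf view2 P) = \<I>[P](U2; U1 | Qrv \<triangle> U0)"
    unfolding mi_defs by (rule cond_mi_cong[OF fin]) (auto simp: joint_rv_def)
  then show ?thesis
    unfolding mi_defs using cond_mi_commute[OF fin, of U2 U1] by simp
qed

lemma sym_objective_view1: "sym_objective (map_pmf view1 P) = sym_objective P"
  by (simp add: sym_objective_eq mi_view1)

text \<open>\<open>mi_U12\<close> agrees in both views. Writing it as the mean of the two makes the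
  sum bounds symmetric in \<open>P1\<close> and \<open>P2\<close>, ready for averaging.\<close>

lemma in_region_for_views:
  fixes R :: real
  defines "P1 \<equiv> map_pmf view1 P" and "P2 \<equiv> map_pmf view2 P"
  shows "in_region_for P R R \<longleftrightarrow>
    R \<le> mi_U01 P1 - mi_V01 P1 \<and>
    R \<le> mi_U01 P2 - mi_V01 P2 \<and>
    2 * R \<le> mi_U1 P1 + mi_U1 P2 + min (mi_U0 P1) (mi_U0 P2) - (mi_U12 P1 + mi_U12 P2) / 2
      - mi_V1 P1 - mi_V1 P2 - max (mi_V0 P1) (mi_V0 P2) \<and>
    2 * R \<le> mi_U01 P1 + mi_U01 P2 - (mi_U12 P1 + mi_U12 P2) / 2 - mi_V01 P1 - mi_V01 P2"
  unfolding P1_def P2_def mi_view1 mi_U12_view2 unfolding mi_view2 unfolding mi_defs in_region_for_def by simp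

end

section \<open>The joint law and its projections to the two views\<close>

lemma finite_set_joint_pmf:
  fixes pS :: "'s::finite pmf" and W :: "'x::finite \<Rightarrow> 's \<Rightarrow> ('y1::finite \<times> 'y2::finite) pmf"
  assumes "is_aux a"
  shows "finite (set_pmf (joint_pmf pS W a))"
proof -
  have 1: "finite (set_pmf (p_Q a))"
    using assms by (auto simp: is_aux_def intro: finite_subset)
  have 2: "finite (set_pmf (p_U a q))" if "q \<in> set_pmf (p_Q a)" for q
  proof (rule finite_subset)
    show "set_pmf (p_U a q) \<subseteq> alph_U0 a \<times> alph_U1 a \<times> alph_U2 a"
      using assms that unfolding is_aux_def by blast
    show "finite (alph_U0 a \<times> alph_U1 a \<times> alph_U2 a)"
      using assms unfolding is_aux_def by blast
  qed
  \<comment> \<open>\<open>is_aux\<close> constrains the kernels on the alphabets only, so the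
    supports of \<open>p_Q\<close> and \<open>p_U\<close> must first place \<open>q\<close> and
    \<open>u\<close> there.\<close>
  have 3: "finite (set_pmf (p_V a u s q))" if "q \<in> set_pmf (p_Q a)" "u \<in> set_pmf (p_U a q)" for q u s
  proof (rule finite_subset)
    have "q \<in> alph_Q a" "u \<in> alph_U0 a \<times> alph_U1 a \<times> alph_U2 a"
      using assms that unfolding is_aux_def by blast+
    then show "set_pmf (p_V a u s q) \<subseteq> alph_V0 a \<times> alph_V1 a \<times> alph_V2 a"
      using assms unfolding is_aux_def by blast
    show "finite (alph_V0 a \<times> alph_V1 a \<times> alph_V2 a)"
      using assms unfolding is_aux_def by blast
  qed
  have 4: "finite (set_pmf (W x s))" "finite (set_pmf pS)" for x s
    by (rule finite_subset[OF subset_UNIV]; simp)+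
  show ?thesis
    unfolding joint_pmf_def Let_def by (auto simp: 1 2 3 4 case_prod_unfold intro!: finite_UN_I)
qed

lemma Qrv_joint_pmf: "Qrv ` set_pmf (joint_pmf pS W a) \<subseteq> set_pmf (p_Q a)"
  by (auto simp: joint_pmf_def Let_def case_prod_unfold)

text \<open>Only a marginal of \<open>W\<close> survives the projection. Channel symmetry relates
  marginals and says nothing about the joint law of the outputs, hence the detour through
  views.\<close>

lemma map_view1_joint_pmf:
  "map_pmf view1 (joint_pmf pS W a) =
    do { q \<leftarrow> p_Q a;
         (u0, u1, u2) \<leftarrow> p_U a q;
         s \<leftarrow> pS;
         y \<leftarrow> map_pmf fst (W (x_fun a u0 u1 u2 q) s);
         (v0, v1, v2) \<leftarrow> p_V a (u0, u1, u2) s q;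
         return_pmf (Outcome q u0 u1 u2 (x_fun a u0 u1 u2 q) s y () v0 v1 v2) }"
  by (simp add: joint_pmf_def Let_def map_bind_pmf bind_map_pmf case_prod_unfold view1_def)

lemma map_view2_joint_pmf:
  "map_pmf view2 (joint_pmf pS W a) =
    do { q \<leftarrow> p_Q a;
         (u0, u1, u2) \<leftarrow> p_U a q;
         s \<leftarrow> pS;
         y \<leftarrow> map_pmf snd (W (x_fun a u0 u1 u2 q) s);
         (v0, v1, v2) \<leftarrow> p_V a (u0, u1, u2) s q;
         return_pmf (Outcome q u0 u2 u1 (x_fun a u0 u1 u2 q) s y () v0 v2 v1) }"
  by (simp add: joint_pmf_def Let_def map_bind_pmf bind_map_pmf case_prod_unfold view2_def)

section \<open>Exchanging the receivers\<close>

fun swap23 :: "'a \<times> 'b \<times> 'c \<Rightarrow> 'a \<times> 'c \<times> 'b" where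
  "swap23 (x, y, z) = (x, z, y)"

lemma swap23_sel [simp]:
  "fst (swap23 t) = fst t" "fst (snd (swap23 t)) = snd (snd t)" "snd (snd (swap23 t)) = fst (snd t)"
  by (cases t; simp)+

lemma swap23_swap23 [simp]: "swap23 (swap23 t) = t"
  by (cases t) simp

lemma map_swap23_swap23 [simp]: "map_pmf swap23 (map_pmf swap23 p) = p"
  by (simp add: map_pmf_comp)

lemma bij_swap23: "bij swap23"
  by (rule o_bij[of swap23]) (simp_all add: fun_eq_iff)

lemma pmf_map_swap23 [simp]: "pmf (map_pmf swap23 p) (x, y, z) = pmf p (x, z, y)"
  using pmf_map_inj'[OF bij_is_inj[OF bij_swap23], of p "(x, z, y)"] by simp

text \<open>\<open>\<sigma>\<close> acts only on the state read by the V kernel. It is later taken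
  to be \<open>inv \<pi>\<close>, so that substituting \<open>\<pi> s\<close> for the state restores
  the original kernel.\<close>

definition exchange :: "('s \<Rightarrow> 's) \<Rightarrow> ('x, 's) aux \<Rightarrow> ('x, 's) aux" where
  "exchange \<sigma> a = a\<lparr>
     alph_U1 := alph_U2 a, alph_U2 := alph_U1 a,
     alph_V1 := alph_V2 a, alph_V2 := alph_V1 a,
     p_U := \<lambda>q. map_pmf swap23 (p_U a q),
     x_fun := \<lambda>u0 u1 u2. x_fun a u0 u2 u1,
     p_V := \<lambda>u s q. map_pmf swap23 (p_V a (swap23 u) (\<sigma> s) q)\<rparr>"

lemma exchange_sel [simp]:
  "alph_Q (exchange \<sigma> a) = alph_Q a" "alph_U0 (exchange \<sigma> a) = alph_U0 a" "alph_V0 (exchange \<sigma> a) = alph_V0 a"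
  "alph_U1 (exchange \<sigma> a) = alph_U2 a" "alph_U2 (exchange \<sigma> a) = alph_U1 a"
  "alph_V1 (exchange \<sigma> a) = alph_V2 a" "alph_V2 (exchange \<sigma> a) = alph_V1 a"
  "p_Q (exchange \<sigma> a) = p_Q a" "p_U (exchange \<sigma> a) q = map_pmf swap23 (p_U a q)"
  "x_fun (exchange \<sigma> a) u0 u1 u2 q = x_fun a u0 u2 u1 q"
  "p_V (exchange \<sigma> a) u s q = map_pmf swap23 (p_V a (swap23 u) (\<sigma> s) q)"
  by (simp_all add: exchange_def)

lemma is_aux_exchange: "is_aux a \<Longrightarrow> is_aux (exchange \<sigma> a)"
  unfolding is_aux_def exchange_sel set_map_pmf by fastforce

lemma is_aux_exchange_funpow: "is_aux a \<Longrightarrow> is_aux ((exchange \<sigma> ^^ j) a)"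
  by (induction j) (simp_all add: is_aux_exchange)

lemma exchange_twice: "exchange \<sigma> (exchange \<sigma> a) = a\<lparr>p_V := \<lambda>u s. p_V a u ((\<sigma> ^^ 2) s)\<rparr>"
  by (simp add: exchange_def numeral_2_eq_2)

text \<open>The swaps cancel in pairs and only the state shifts accumulate, so an even number of
  exchanges is the identity once that power of \<open>\<sigma>\<close> is.\<close>

lemma exchange_funpow_even: "(exchange \<sigma> ^^ (2 * n)) a = a\<lparr>p_V := \<lambda>u s. p_V a u ((\<sigma> ^^ (2 * n)) s)\<rparr>"
  by (induction n) (simp_all add: exchange_twice numeral_2_eq_2 funpow_swap1)

text \<open>One exchange turns the second view into the first by \<open>snd_fst\<close> and the
  first into the second by \<open>fst_snd\<close>; iterating exchanges calls on both in
  alternation.\<close>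

locale exchangeable_channel =
  fixes pS :: "'s::finite pmf" and W :: "'x::finite \<Rightarrow> 's \<Rightarrow> ('y::finite \<times> 'y) pmf" and \<pi> :: "'s \<Rightarrow> 's"
  assumes bij: "bij \<pi>" and pS_inv: "pmf pS s = pmf pS (\<pi> s)"
    and fst_snd: "map_pmf fst (W x s) = map_pmf snd (W x (\<pi> s))"
    and snd_fst: "map_pmf snd (W x s) = map_pmf fst (W x (\<pi> s))"
begin

lemma map_pS: "map_pmf \<pi> pS = pS"
proof (rule pmf_eqI)
  fix s
  have "pmf (map_pmf \<pi> pS) (\<pi> (inv \<pi> s)) = pmf pS (inv \<pi> s)"
    by (rule pmf_map_inj') (use bij bij_is_inj in blast)
  then show "pmf (map_pmf \<pi> pS) s = pmf pS s"
    using pS_inv[of "inv \<pi> s"] bij by (simp add: bij_is_surj surj_f_inv_f)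
qed

lemma bind_pS: "bind_pmf pS F = bind_pmf pS (\<lambda>s. F (\<pi> s))"
  by (subst map_pS[symmetric]) (simp only: bind_map_pmf)

text \<open>Substituting \<open>\<pi> s\<close> for the state preserves its law and cancels
  \<open>inv \<pi>\<close> in the V kernel. One receiver's output marginal at \<open>\<pi> s\<close>
  is the other's at \<open>s\<close>, so only the relabelling of S remains.\<close>

lemma view_joint_exchange:
  "map_pmf view1 (joint_pmf pS W (exchange (inv \<pi>) a)) = map_pmf (relabel id \<pi>) (map_pmf view2 (joint_pmf pS W a))"
  "map_pmf view2 (joint_pmf pS W (exchange (inv \<pi>) a)) = map_pmf (relabel id \<pi>) (map_pmf view1 (joint_pmf pS W a))"
proof -
  have inv: "inv \<pi> (\<pi> s) = s" for s
    using bij by (simp add: bij_is_inj)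
  show "map_pmf view1 (joint_pmf pS W (exchange (inv \<pi>) a)) = map_pmf (relabel id \<pi>) (map_pmf view2 (joint_pmf pS W a))"
    unfolding map_view1_joint_pmf map_view2_joint_pmf
    apply (simp add: map_bind_pmf case_prod_unfold bind_map_pmf[of swap23])
    apply (rule bind_pmf_cong[OF refl], rule bind_pmf_cong[OF refl])
    apply (subst bind_pS)
    apply (simp add: inv snd_fst[symmetric] relabel_def)
    done
  show "map_pmf view2 (joint_pmf pS W (exchange (inv \<pi>) a)) = map_pmf (relabel id \<pi>) (map_pmf view1 (joint_pmf pS W a))"
    unfolding map_view1_joint_pmf map_view2_joint_pmf
    apply (simp add: map_bind_pmf case_prod_unfold bind_map_pmf[of swap23])
    apply (rule bind_pmf_cong[OF refl], rule bind_pmf_cong[OF refl])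
    apply (subst bind_pS)
    apply (simp add: inv fst_snd[symmetric] relabel_def)
    done
qed

end

section \<open>Symmetric auxiliaries achieve their objective\<close>

text \<open>Points of mass zero are included: injectivity on \<open>A\<close> keeps their images
  outside the image of the support.\<close>

lemma pmf_map_inj_superset:
  assumes "inj_on f A" "set_pmf p \<subseteq> A" "x \<in> A"
  shows "pmf (map_pmf f p) (f x) = pmf p x"
proof (cases "x \<in> set_pmf p")
  case True
  then show ?thesis
    using assms by (intro pmf_map_inj) (auto intro: inj_on_subset)
next
  case False
  then have "f x \<notin> f ` set_pmf p"
    using assms by (auto dest: inj_onD)
  then have "pmf (map_pmf f p) (f x) = 0"
    by (simp add: pmf_eq_0_set_pmf)
  moreover have "pmf p x = 0"
    using False by (simp add: pmf_eq_0_set_pmf)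
  ultimately show ?thesis
    by simp
qed

text \<open>The first argument of every term consists of U variables only, so it carries no
  information.\<close>

lemma mi_terms_const:
  fixes P :: "('x, 's::finite, 'y1::finite, 'y2) outcome pmf"
  assumes T: "T \<in> mi_terms" and fin: "finite (set_pmf P)"
    and const: "\<And>\<omega>. \<omega> \<in> set_pmf P \<Longrightarrow> U0 \<omega> = c0 \<and> U1 \<omega> = c1 \<and> U2 \<omega> = c2"
  shows "T P = 0"
  using T unfolding mi_terms_def
  by (elim insertE emptyE; simp only: mi_defs)
    (rule cond_mi_const[OF fin, of _ c1] cond_mi_const[OF fin, of _ c0] cond_mi_const[OF fin, of _ "(c0, c1)"]
      cond_mi_const[OF fin, of _ "(c0, c1, c2)"]; simp add: joint_rv_def const; fail)+

lemma zero_in_SW_region: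
  fixes pS :: "'s::finite pmf" and W :: "'x::finite \<Rightarrow> 's \<Rightarrow> ('y1::finite \<times> 'y2::finite) pmf"
  shows "(0, 0) \<in> SW_region pS W"
proof -
  define a :: "('x, 's) aux" where
    "a = \<lparr>alph_Q = {0}, alph_U0 = {0}, alph_U1 = {0}, alph_U2 = {0}, alph_V0 = {0}, alph_V1 = {0}, alph_V2 = {0},
      p_Q = return_pmf 0, p_U = \<lambda>_. return_pmf (0, 0, 0), x_fun = \<lambda>_ _ _ _. undefined,
      p_V = \<lambda>_ _ _. return_pmf (0, 0, 0)\<rparr>"
  have a: "is_aux a"
    by (simp add: a_def is_aux_def)
  let ?P = "joint_pmf pS W a"
  have fin: "finite (set_pmf ?P)"
    by (rule finite_set_joint_pmf[OF a])
  have const: "U0 \<omega> = 0 \<and> U1 \<omega> = 0 \<and> U2 \<omega> = 0" if "\<omega> \<in> set_pmf ?P" for \<omega>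
    using that by (auto simp: joint_pmf_def a_def case_prod_unfold)
  have "\<forall>T\<in>mi_terms. T (map_pmf view1 ?P) = 0"
    by (rule ballI, erule mi_terms_const[where ?c0.0 = 0 and ?c1.0 = 0 and ?c2.0 = 0]) (use fin const in auto)
  moreover have "\<forall>T\<in>mi_terms. T (map_pmf view2 ?P) = 0"
    by (rule ballI, erule mi_terms_const[where ?c0.0 = 0 and ?c1.0 = 0 and ?c2.0 = 0]) (use fin const in auto)
  ultimately have "in_region_for ?P 0 0"
    unfolding in_region_for_views[OF fin] by (simp add: mi_terms_def)
  with a show ?thesis
    by (auto simp: SW_region_def)
qed

context exchangeable_channel
begin

text \<open>The symmetry conditions are pointwise equations on the alphabets. They become equations
  between pmfs because both sides vanish outside the alphabets; \<open>f\<close> is the bijection of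
  Q they provide.\<close>

lemma view2_joint_symmetric:
  assumes a: "is_aux a" and sym: "symmetric_aux \<pi> a"
  obtains f where "inj_on f (alph_Q a)"
    and "map_pmf view2 (joint_pmf pS W a) = map_pmf (relabel f \<pi>) (map_pmf view1 (joint_pmf pS W a))"
proof -
  from sym obtain f where f: "bij_betw f (alph_Q a) (alph_Q a)"
    and Q: "\<And>q. q \<in> alph_Q a \<Longrightarrow> pmf (p_Q a) q = pmf (p_Q a) (f q)"
    and U: "\<And>q u0 u1 u2. q \<in> alph_Q a \<Longrightarrow> u0 \<in> alph_U0 a \<Longrightarrow> u1 \<in> alph_U1 a \<Longrightarrow> u2 \<in> alph_U2 a \<Longrightarrow>
        pmf (p_U a q) (u0, u1, u2) = pmf (p_U a (f q)) (u0, u2, u1)"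
    and X: "\<And>q u0 u1 u2. q \<in> alph_Q a \<Longrightarrow> u0 \<in> alph_U0 a \<Longrightarrow> u1 \<in> alph_U1 a \<Longrightarrow> u2 \<in> alph_U2 a \<Longrightarrow>
        x_fun a u0 u1 u2 q = x_fun a u0 u2 u1 (f q)"
    and V: "\<And>q u0 u1 u2 s v0 v1 v2. q \<in> alph_Q a \<Longrightarrow> u0 \<in> alph_U0 a \<Longrightarrow> u1 \<in> alph_U1 a \<Longrightarrow> u2 \<in> alph_U2 a \<Longrightarrow>
        v0 \<in> alph_V0 a \<Longrightarrow> v1 \<in> alph_V1 a \<Longrightarrow> v2 \<in> alph_V2 a \<Longrightarrow>
        pmf (p_V a (u0, u1, u2) s q) (v0, v1, v2) = pmf (p_V a (u0, u2, u1) (\<pi> s) (f q)) (v0, v2, v1)"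
    unfolding symmetric_aux_def by blast
  have alph: "alph_U1 a = alph_U2 a" "alph_V1 a = alph_V2 a"
    using sym unfolding symmetric_aux_def by blast+
  have set_Q: "set_pmf (p_Q a) \<subseteq> alph_Q a"
    using a unfolding is_aux_def by blast
  have set_U: "set_pmf (p_U a q) \<subseteq> alph_U0 a \<times> alph_U2 a \<times> alph_U2 a" if "q \<in> alph_Q a" for q
    using a that unfolding is_aux_def alph by blast
  have set_V: "set_pmf (p_V a u s q) \<subseteq> alph_V0 a \<times> alph_V2 a \<times> alph_V2 a"
    if "q \<in> alph_Q a" "u \<in> alph_U0 a \<times> alph_U2 a \<times> alph_U2 a" for q u s
    using a that unfolding is_aux_def alph by blast
  note inj = bij_betw_imp_inj_on[OF f]
  have f_in: "f q \<in> alph_Q a" if "q \<in> alph_Q a" for q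
    using f that by (auto simp: bij_betw_def)
  have pQ: "map_pmf f (p_Q a) = p_Q a"
  proof (rule pmf_eqI)
    fix q
    show "pmf (map_pmf f (p_Q a)) q = pmf (p_Q a) q"
    proof (cases "q \<in> alph_Q a")
      case True
      then obtain q' where "q' \<in> alph_Q a" "q = f q'"
        using f by (auto simp: bij_betw_def)
      then show ?thesis
        using pmf_map_inj_superset[OF inj set_Q] Q by simp
    next
      case False
      then have "q \<notin> set_pmf (p_Q a)" "q \<notin> set_pmf (map_pmf f (p_Q a))"
        using set_Q f_in by auto
      then have "pmf (p_Q a) q = 0" "pmf (map_pmf f (p_Q a)) q = 0"
        by (simp_all only: pmf_eq_0_set_pmf not_False_eq_True)
      then show ?thesis
        by simp
    qed
  qed
  have pU: "p_U a (f q) = map_pmf swap23 (p_U a q)" if q: "q \<in> alph_Q a" for q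
  proof (rule pmf_eqI, clarify)
    fix u0 u1 u2
    show "pmf (p_U a (f q)) (u0, u1, u2) = pmf (map_pmf swap23 (p_U a q)) (u0, u1, u2)"
    proof (cases "u0 \<in> alph_U0 a \<and> u1 \<in> alph_U2 a \<and> u2 \<in> alph_U2 a")
      case True
      then show ?thesis using U[OF q, of u0 u2 u1] by (simp add: alph)
    next
      case False
      then have "(u0, u1, u2) \<notin> set_pmf (p_U a (f q))" "(u0, u2, u1) \<notin> set_pmf (p_U a q)"
        using set_U[OF q] set_U[OF f_in[OF q]] by auto
      then show ?thesis
        by (simp add: set_pmf_iff)
    qed
  qed
  have pV: "p_V a (swap23 u) (\<pi> s) (f q) = map_pmf swap23 (p_V a u s q)"
    if q: "q \<in> alph_Q a" and u: "u \<in> alph_U0 a \<times> alph_U2 a \<times> alph_U2 a" for q u s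
  proof (rule pmf_eqI, clarify)
    fix v0 v1 v2
    have u': "swap23 u \<in> alph_U0 a \<times> alph_U2 a \<times> alph_U2 a"
      using u by (cases u) simp
    show "pmf (p_V a (swap23 u) (\<pi> s) (f q)) (v0, v1, v2) = pmf (map_pmf swap23 (p_V a u s q)) (v0, v1, v2)"
    proof (cases "v0 \<in> alph_V0 a \<and> v1 \<in> alph_V2 a \<and> v2 \<in> alph_V2 a")
      case True
      then show ?thesis using V[OF q, of "fst u" "fst (snd u)" "snd (snd u)" v0 v2 v1 s] u
        by (cases u) (simp add: alph)
    next
      case False
      then have "(v0, v1, v2) \<notin> set_pmf (p_V a (swap23 u) (\<pi> s) (f q))" "(v0, v2, v1) \<notin> set_pmf (p_V a u s q)"
        using set_V[OF q u, of s] set_V[OF f_in[OF q] u', of "\<pi> s"] by auto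
      then show ?thesis
        by (simp add: set_pmf_iff)
    qed
  qed
  have "map_pmf view2 (joint_pmf pS W a) = map_pmf (relabel f \<pi>) (map_pmf view1 (joint_pmf pS W a))"
    unfolding map_view1_joint_pmf map_view2_joint_pmf
    \<comment> \<open>Q is re-indexed by \<open>f\<close>, the U and V triples by
      \<open>swap23\<close> and S by \<open>\<pi>\<close>; the second view is thereby matched with
      the first draw by draw.\<close>
    apply (subst pQ[symmetric])
    apply (simp add: map_bind_pmf case_prod_unfold bind_map_pmf[of f])
    apply (rule bind_pmf_cong[OF refl])
    subgoal for q
      apply (subst pU)
      subgoal using set_Q by blast
      apply (simp add: bind_map_pmf[of swap23])
      apply (rule bind_pmf_cong[OF refl])
      subgoal premises prems for u
      proof -
        have q: "q \<in> alph_Q a" and u: "u \<in> alph_U0 a \<times> alph_U2 a \<times> alph_U2 a"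
          using prems set_Q set_U by blast+
        have x: "x_fun a (fst u) (snd (snd u)) (fst (snd u)) (f q) = x_fun a (fst u) (fst (snd u)) (snd (snd u)) q"
          using X[OF q, of "fst u" "fst (snd u)" "snd (snd u)"] u by (auto simp: alph)
        have sw: "(fst u, snd (snd u), fst (snd u)) = swap23 u"
          by (cases u) simp
        show ?thesis
          apply (subst bind_pS)
          apply (simp add: x sw pV[OF q u] bind_map_pmf[of swap23] fst_snd[symmetric] relabel_def)
          done
      qed
      done
    done
  with inj show ?thesis
    by (rule that)
qed

lemma sym_objective_le_R_sym:
  assumes a: "is_aux a" and sym: "symmetric_aux \<pi> a"
  shows "ereal (sym_objective (joint_pmf pS W a)) \<le> R_sym pS W"
proof -
  let ?P = "joint_pmf pS W a" and ?R = "sym_objective (joint_pmf pS W a)"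
  let ?P1 = "map_pmf view1 ?P"
  have fin: "finite (set_pmf ?P)"
    by (rule finite_set_joint_pmf[OF a])
  obtain f where f: "inj_on f (alph_Q a)" and P2: "map_pmf view2 ?P = map_pmf (relabel f \<pi>) ?P1"
    by (rule view2_joint_symmetric[OF a sym])
  have "Qrv ` set_pmf ?P1 \<subseteq> alph_Q a"
    using Qrv_joint_pmf[of pS W a] a unfolding is_aux_def by (simp add: image_image) blast
  then have "inj_on f (Qrv ` set_pmf ?P1)"
    by (rule inj_on_subset[OF f])
  then have "\<forall>T\<in>mi_terms. T (map_pmf view2 ?P) = T ?P1"
    unfolding P2 by (intro ballI mi_terms_relabel bij_is_inj[OF bij]) (simp_all add: fin)
  then have eq: "mi_U1 (map_pmf view2 ?P) = mi_U1 ?P1" "mi_U0 (map_pmf view2 ?P) = mi_U0 ?P1"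
      "mi_U01 (map_pmf view2 ?P) = mi_U01 ?P1" "mi_U12 (map_pmf view2 ?P) = mi_U12 ?P1"
      "mi_V1 (map_pmf view2 ?P) = mi_V1 ?P1" "mi_V0 (map_pmf view2 ?P) = mi_V0 ?P1"
      "mi_V01 (map_pmf view2 ?P) = mi_V01 ?P1"
    by (simp_all add: mi_terms_def)
  \<comment> \<open>The individual rate bounds carry no \<open>mi_U12\<close> penalty, so its sign
    derives them from the second term of the objective.\<close>
  have "0 \<le> mi_U12 ?P"
    unfolding mi_defs by (rule cond_mi_nonneg[OF fin])
  then have "in_region_for ?P ?R ?R"
    unfolding in_region_for_views[OF fin] eq mi_view1[OF fin] sym_objective_eq
    by (auto simp: min_def)
  \<comment> \<open>Rates in the region are nonnegative, so a negative objective is replaced by the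
    rate pair (0, 0).\<close>
  then have "(max 0 ?R, max 0 ?R) \<in> SW_region pS W"
    using a zero_in_SW_region[of pS W] by (cases "0 \<le> ?R") (auto simp: SW_region_def max_def)
  then have "ereal (max 0 ?R) \<le> R_sym pS W"
    unfolding R_sym_def by (intro Sup_upper) blast
  then show ?thesis
    by (rule order_trans[rotated]) simp
qed

end

section \<open>Symmetrization of arbitrary auxiliaries\<close>

text \<open>Symmetric auxiliaries need common alphabets for U1, U2 and for V1, V2; one initial
  segment containing every alphabet serves for all.\<close>

lemma is_aux_uniform_alphabets:
  fixes a :: "('x::finite, 's::finite) aux"
  assumes a: "is_aux a"
  obtains b K where "is_aux b" "\<And>pS W. joint_pmf pS W b = joint_pmf pS W a"
    "alph_U0 b = {..K}" "alph_U1 b = {..K}" "alph_U2 b = {..K}"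
    "alph_V0 b = {..K}" "alph_V1 b = {..K}" "alph_V2 b = {..K}"
proof -
  let ?A = "alph_U0 a \<union> alph_U1 a \<union> alph_U2 a \<union> alph_V0 a \<union> alph_V1 a \<union> alph_V2 a"
  have "finite ?A"
    using a by (auto simp: is_aux_def)
  then obtain K where K: "?A \<subseteq> {..K}"
    using finite_nat_iff_bounded_le by auto
  define b where "b = a\<lparr>alph_U0 := {..K}, alph_U1 := {..K}, alph_U2 := {..K},
    alph_V0 := {..K}, alph_V1 := {..K}, alph_V2 := {..K},
    p_V := \<lambda>u s q. if u \<in> alph_U0 a \<times> alph_U1 a \<times> alph_U2 a then p_V a u s q else return_pmf (0, 0, 0)\<rparr>"
  have set_Q: "set_pmf (p_Q a) \<subseteq> alph_Q a"
    using a unfolding is_aux_def by blast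
  have set_U: "set_pmf (p_U a q) \<subseteq> alph_U0 a \<times> alph_U1 a \<times> alph_U2 a" if "q \<in> alph_Q a" for q
    using a that unfolding is_aux_def by blast
  have set_V: "set_pmf (p_V a u s q) \<subseteq> alph_V0 a \<times> alph_V1 a \<times> alph_V2 a"
    if "q \<in> alph_Q a" "u \<in> alph_U0 a \<times> alph_U1 a \<times> alph_U2 a" for q u s
    using a that unfolding is_aux_def by blast
  have KU: "alph_U0 a \<times> alph_U1 a \<times> alph_U2 a \<subseteq> {..K} \<times> {..K} \<times> {..K}"
    and KV: "alph_V0 a \<times> alph_V1 a \<times> alph_V2 a \<subseteq> {..K} \<times> {..K} \<times> {..K}"
    using K by (intro Sigma_mono; blast)+
  have V: "set_pmf (p_V b u s q) \<subseteq> {..K} \<times> {..K} \<times> {..K}" if "q \<in> alph_Q a" for u s q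
    using order_trans[OF set_V[OF that] KV] by (auto simp: b_def)
  have "is_aux b"
    using a order_trans[OF set_U KU] V unfolding is_aux_def by (auto simp: b_def)
  moreover have "joint_pmf pS W b = joint_pmf pS W a" for pS :: "'s pmf" and W :: "'x \<Rightarrow> 's \<Rightarrow> ('y1 \<times> 'y2) pmf"
  proof -
    have "p_V b u s q = p_V a u s q" if "q \<in> set_pmf (p_Q a)" "u \<in> set_pmf (p_U a q)" for u s q
    proof -
      have "u \<in> alph_U0 a \<times> alph_U1 a \<times> alph_U2 a"
        using that set_Q set_U by blast
      then show ?thesis
        by (simp add: b_def)
    qed
    moreover have "p_Q b = p_Q a" "p_U b = p_U a" "x_fun b = x_fun a"
      by (simp_all add: b_def)
    ultimately show ?thesis
      unfolding joint_pmf_def case_prod_unfold Let_def by (intro bind_pmf_cong refl) auto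
  qed
  ultimately show ?thesis
    by (rule that) (simp_all add: b_def)
qed

lemma sum_alternating:
  fixes x y :: real and n :: nat
  shows "(\<Sum>j<2 * n. if even j then x else y) = n * (x + y)"
  by (induction n) (simp_all add: algebra_simps)

context exchangeable_channel
begin

lemma mi_terms_joint_exchange:
  assumes a: "is_aux a" and T: "T \<in> mi_terms"
  shows "T (map_pmf view1 (joint_pmf pS W (exchange (inv \<pi>) a))) = T (map_pmf view2 (joint_pmf pS W a))"
    and "T (map_pmf view2 (joint_pmf pS W (exchange (inv \<pi>) a))) = T (map_pmf view1 (joint_pmf pS W a))"
  unfolding view_joint_exchange
  by (rule mi_terms_relabel[OF T]; simp add: finite_set_joint_pmf[OF a] bij_is_inj[OF bij])+

text \<open>Both views go through one induction, since each exchange expresses either view by the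
  other.\<close>

lemma mi_terms_joint_exchange_funpow:
  assumes a: "is_aux a" and T: "T \<in> mi_terms"
  shows "T (map_pmf view1 (joint_pmf pS W ((exchange (inv \<pi>) ^^ j) a))) =
      (if even j then T (map_pmf view1 (joint_pmf pS W a)) else T (map_pmf view2 (joint_pmf pS W a))) \<and>
    T (map_pmf view2 (joint_pmf pS W ((exchange (inv \<pi>) ^^ j) a))) =
      (if even j then T (map_pmf view2 (joint_pmf pS W a)) else T (map_pmf view1 (joint_pmf pS W a)))"
  by (induction j) (simp_all add: mi_terms_joint_exchange[OF is_aux_exchange_funpow[OF a] T])

lemma symmetrize:
  assumes a: "is_aux a"
  obtains b where "is_aux b" "symmetric_aux \<pi> b"
    "\<And>T. T \<in> mi_terms \<Longrightarrow> T (map_pmf view1 (joint_pmf pS W b)) =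
      (T (map_pmf view1 (joint_pmf pS W a)) + T (map_pmf view2 (joint_pmf pS W a))) / 2"
proof -
  obtain c K where c: "is_aux c" and joint_c: "joint_pmf pS W c = joint_pmf pS W a"
    and alph: "alph_U0 c = {..K}" "alph_U1 c = {..K}" "alph_U2 c = {..K}"
      "alph_V0 c = {..K}" "alph_V1 c = {..K}" "alph_V2 c = {..K}"
    by (rule is_aux_uniform_alphabets[OF a]) blast
  let ?\<sigma> = "inv \<pi>"
  \<comment> \<open>A bijection of the finite state alphabet has finite order.\<close>
  have "permutation ?\<sigma>"
    using bij by (simp add: permutation bij_imp_bij_inv)
  then obtain n where n: "?\<sigma> ^^ n = id" "0 < n"
    by (rule permutation_is_nilpotent)
  \<comment> \<open>The number of exchanges must be even to return the receivers to their places and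
    a multiple of \<open>n\<close> to return the state.\<close>
  let ?N = "2 * n"
  have \<sigma>N: "?\<sigma> ^^ ?N = id"
    using n(1) by (simp add: mult_2 funpow_add)
  define c' where "c' j = (exchange ?\<sigma> ^^ j) c" for j
  \<comment> \<open>The modified auxiliaries form a cycle: at the last index, one more exchange
    gives back \<open>c\<close> as a record, including its V kernel.\<close>
  have c'_Suc: "c' (Suc j mod ?N) = exchange ?\<sigma> (c' j)" if "j < ?N" for j
  proof (cases "Suc j = ?N")
    case True
    have "exchange ?\<sigma> (c' j) = c' ?N"
      by (simp add: c'_def flip: True)
    also have "\<dots> = c"
      unfolding c'_def exchange_funpow_even \<sigma>N by simp
    also have "\<dots> = c' (Suc j mod ?N)"
      unfolding True by (simp add: c'_def)
    finally show ?thesis ..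
  next
    case False
    with that have "Suc j mod ?N = Suc j"
      by (intro mod_less) linarith
    then show ?thesis
      by (simp only: c'_def) simp
  qed
  have c': "is_aux (c' j)" for j
    unfolding c'_def by (rule is_aux_exchange_funpow[OF c])
  have c'_alph: "alph_Q (c' j) = alph_Q c \<and> p_Q (c' j) = p_Q c \<and>
      alph_U0 (c' j) = {..K} \<and> alph_U1 (c' j) = {..K} \<and> alph_U2 (c' j) = {..K} \<and>
      alph_V0 (c' j) = {..K} \<and> alph_V1 (c' j) = {..K} \<and> alph_V2 (c' j) = {..K}" for j
    unfolding c'_def by (induction j) (simp_all add: alph)
  have set_Q: "set_pmf (p_Q c) \<subseteq> alph_Q c"
    using c unfolding is_aux_def by blast
  have set_U: "set_pmf (p_U (c' j) q) \<subseteq> {..K} \<times> {..K} \<times> {..K}" if "q \<in> alph_Q c" for j q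
    using c'[of j] that c'_alph[of j] unfolding is_aux_def by simp
  have set_V: "set_pmf (p_V (c' j) u s q) \<subseteq> {..K} \<times> {..K} \<times> {..K}"
    if "q \<in> alph_Q c" "u \<in> {..K} \<times> {..K} \<times> {..K}" for j q u s
    using c'[of j] that c'_alph[of j] unfolding is_aux_def by metis
  \<comment> \<open>The new time-sharing variable is a pair (q, j). As \<open>symmetric_aux\<close>
    asks for an alphabet {1..m}, pairs are encoded by \<open>g\<close> and decoded by
    \<open>h\<close>.\<close>
  let ?A = "alph_Q c \<times> {..<?N}"
  have "finite ?A"
    using c by (auto simp: is_aux_def)
  then obtain h where h: "bij_betw h {1..card ?A} ?A"
    using ex_bij_betw_nat_finite_1 by blast
  define m where "m = card ?A"
  note h = h[folded m_def]
  define g where "g = inv_into {1..m} h"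
  have g: "bij_betw g ?A {1..m}"
    unfolding g_def by (rule bij_betw_inv_into[OF h])
  have hg: "h (g z) = z" if "z \<in> ?A" for z
    unfolding g_def by (rule bij_betw_inv_into_right[OF h that])
  have gh: "g (h i) = i" if "i \<in> {1..m}" for i
    unfolding g_def by (rule bij_betw_inv_into_left[OF h that])
  have h_in: "h i \<in> ?A" if "i \<in> {1..m}" for i
    using bij_betwE[OF h] that by blast
  let ?J = "pmf_of_set {..<?N}"
  have J: "finite {..<?N}" "{..<?N} \<noteq> {}"
    using n(2) by (auto simp: lessThan_empty_iff)
  define b where "b = \<lparr>alph_Q = {1..m}, alph_U0 = {..K}, alph_U1 = {..K}, alph_U2 = {..K},
    alph_V0 = {..K}, alph_V1 = {..K}, alph_V2 = {..K},
    p_Q = map_pmf g (pair_pmf (p_Q c) ?J),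
    p_U = \<lambda>i. p_U (c' (snd (h i))) (fst (h i)),
    x_fun = \<lambda>u0 u1 u2 i. x_fun (c' (snd (h i))) u0 u1 u2 (fst (h i)),
    p_V = \<lambda>u s i. p_V (c' (snd (h i))) u s (fst (h i))\<rparr>"
  have set_pair: "set_pmf (pair_pmf (p_Q c) ?J) \<subseteq> ?A"
    using set_Q J by (auto simp: set_pmf_of_set)
  have fst_h: "fst (h i) \<in> alph_Q c" "snd (h i) < ?N" if "i \<in> {1..m}" for i
    using h_in[OF that] by auto
  have b: "is_aux b"
    unfolding is_aux_def
  proof (intro conjI ballI allI)
    show "set_pmf (p_Q b) \<subseteq> alph_Q b"
      using set_pair g by (auto simp: b_def bij_betw_def)
    show "set_pmf (p_U b i) \<subseteq> alph_U0 b \<times> alph_U1 b \<times> alph_U2 b" if "i \<in> alph_Q b" for i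
      using set_U[of "fst (h i)" "snd (h i)"] fst_h[of i] that by (simp add: b_def)
    show "set_pmf (p_V b u s i) \<subseteq> alph_V0 b \<times> alph_V1 b \<times> alph_V2 b"
      if "u \<in> alph_U0 b \<times> alph_U1 b \<times> alph_U2 b" "i \<in> alph_Q b" for i u s
      using set_V[of "fst (h i)" u "snd (h i)" s] fst_h[of i] that by (simp add: b_def)
  qed (simp_all add: b_def)
  \<comment> \<open>The bijection required by the symmetry keeps q and advances j cyclically; it
    preserves the law of Q because j is uniform and independent of q.\<close>
  define r where "r = (\<lambda>(q :: nat, j). (q, Suc j mod ?N))"
  have r_in: "r z \<in> ?A" if "z \<in> ?A" for z
    using that n(2) by (auto simp: r_def)
  have "inj_on r ?A"
  proof (rule inj_onI, clarify)
    fix q j q' j' assume "j < ?N" "j' < ?N" "r (q, j) = r (q', j')"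
    then show "q = q' \<and> j = j'"
      by (auto simp: r_def mod_Suc split: if_splits)
  qed
  then have r: "bij_betw r ?A ?A"
    unfolding bij_betw_def using endo_inj_surj[of ?A r] r_in \<open>finite ?A\<close> by blast
  define f where "f = g \<circ> r \<circ> h"
  have f: "bij_betw f {1..m} {1..m}"
    unfolding f_def by (intro bij_betw_trans[OF h] bij_betw_trans[OF r] g)
  have hf: "h (f i) = (fst (h i), Suc (snd (h i)) mod ?N)" if "i \<in> {1..m}" for i
    using hg[OF r_in[OF h_in[OF that]]] by (simp add: f_def r_def case_prod_unfold)
  have pQ: "pmf (p_Q b) i = pmf (p_Q b) (f i)" if i: "i \<in> {1..m}" for i
  proof -
    have *: "pmf (p_Q b) (g z) = pmf (p_Q c) (fst z) / ?N" if "z \<in> ?A" for z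
      using pmf_map_inj_superset[OF bij_betw_imp_inj_on[OF g] set_pair that] that J
      by (cases z) (simp add: b_def pmf_pair)
    show ?thesis
      using *[OF h_in[OF i]] *[OF r_in[OF h_in[OF i]]] gh[OF i]
      by (simp add: f_def r_def case_prod_unfold)
  qed
  have sym: "symmetric_aux \<pi> b"
    unfolding symmetric_aux_def
  proof (intro conjI exI[of _ f] ballI allI)
    fix i assume "i \<in> alph_Q b"
    then have i: "i \<in> {1..m}"
      by (simp add: b_def)
    show "pmf (p_Q b) i = pmf (p_Q b) (f i)"
      by (rule pQ[OF i])
    \<comment> \<open>The auxiliaries at the next index are an exchange of those at the current one;
      its \<open>inv \<pi>\<close> cancels the \<open>\<pi> s\<close> of the symmetry
      condition.\<close>
    have inv: "inv \<pi> (\<pi> s) = s" for s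
      using bij by (simp add: bij_is_inj)
    fix u0 u1 u2
    show "pmf (p_U b i) (u0, u1, u2) = pmf (p_U b (f i)) (u0, u2, u1)"
      "x_fun b u0 u1 u2 i = x_fun b u0 u2 u1 (f i)"
      by (simp_all add: b_def c'_Suc[OF fst_h(2)[OF i]] hf[OF i])
    fix s v0 v1 v2
    show "pmf (p_V b (u0, u1, u2) s i) (v0, v1, v2) = pmf (p_V b (u0, u2, u1) (\<pi> s) (f i)) (v0, v2, v1)"
      by (simp add: b_def c'_Suc[OF fst_h(2)[OF i]] hf[OF i] inv)
  qed (use f in \<open>auto simp: b_def\<close>)
  \<comment> \<open>Drawing j before q exhibits the joint law as a uniform mixture over the cycle,
    with q replaced by its code.\<close>
  have joint_b: "joint_pmf pS W b = ?J \<bind> (\<lambda>j. map_pmf (relabel (\<lambda>q. g (q, j)) id) (joint_pmf pS W (c' j)))"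
  proof -
    have "joint_pmf pS W b = ?J \<bind> (\<lambda>j. p_Q c \<bind> (\<lambda>q. p_U b (g (q, j)) \<bind> (\<lambda>(u0, u1, u2).
        pS \<bind> (\<lambda>s. W (x_fun b u0 u1 u2 (g (q, j))) s \<bind> (\<lambda>(y1, y2). p_V b (u0, u1, u2) s (g (q, j)) \<bind> (\<lambda>(v0, v1, v2).
        return_pmf (Outcome (g (q, j)) u0 u1 u2 (x_fun b u0 u1 u2 (g (q, j))) s y1 y2 v0 v1 v2)))))))"
      by (subst bind_commute_pmf) (simp add: joint_pmf_def b_def pair_pmf_def bind_map_pmf
        bind_assoc_pmf bind_return_pmf Let_def)
    also have "\<dots> = ?J \<bind> (\<lambda>j. map_pmf (relabel (\<lambda>q. g (q, j)) id) (joint_pmf pS W (c' j)))"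
    proof (rule bind_pmf_cong[OF refl])
      fix j assume "j \<in> set_pmf ?J"
      then have j: "j < ?N"
        using J by (simp add: set_pmf_of_set)
      have b_eq: "p_U b (g (q, j)) = p_U (c' j) q" "x_fun b u0 u1 u2 (g (q, j)) = x_fun (c' j) u0 u1 u2 q"
        "p_V b u s (g (q, j)) = p_V (c' j) u s q" if "q \<in> set_pmf (p_Q c)" for q u0 u1 u2 u s
      proof -
        have "h (g (q, j)) = (q, j)"
          by (rule hg) (use that set_Q j in auto)
        then show "p_U b (g (q, j)) = p_U (c' j) q" "x_fun b u0 u1 u2 (g (q, j)) = x_fun (c' j) u0 u1 u2 q"
          "p_V b u s (g (q, j)) = p_V (c' j) u s q"
          by (simp_all add: b_def)
      qed
      have p_Q_c': "p_Q (c' j) = p_Q c"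
        using c'_alph[of j] by simp
      show "p_Q c \<bind> (\<lambda>q. p_U b (g (q, j)) \<bind> (\<lambda>(u0, u1, u2).
        pS \<bind> (\<lambda>s. W (x_fun b u0 u1 u2 (g (q, j))) s \<bind> (\<lambda>(y1, y2). p_V b (u0, u1, u2) s (g (q, j)) \<bind> (\<lambda>(v0, v1, v2).
        return_pmf (Outcome (g (q, j)) u0 u1 u2 (x_fun b u0 u1 u2 (g (q, j))) s y1 y2 v0 v1 v2)))))) =
        map_pmf (relabel (\<lambda>q. g (q, j)) id) (joint_pmf pS W (c' j))"
        unfolding joint_pmf_def Let_def map_bind_pmf case_prod_unfold map_return_pmf p_Q_c'
        by (rule bind_pmf_cong[OF refl]) (simp add: b_eq relabel_def)
    qed
    finally show ?thesis .
  qed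
  have "T (map_pmf view1 (joint_pmf pS W b)) =
      (T (map_pmf view1 (joint_pmf pS W a)) + T (map_pmf view2 (joint_pmf pS W a))) / 2" if T: "T \<in> mi_terms" for T
  proof -
    let ?E = "\<lambda>j. map_pmf (relabel (\<lambda>q. g (q, j)) id) (map_pmf view1 (joint_pmf pS W (c' j)))"
    have Q_in: "(Qrv \<omega>, j) \<in> ?A" if "\<omega> \<in> set_pmf (joint_pmf pS W (c' j))" "j < ?N" for \<omega> j
    proof -
      have "Qrv \<omega> \<in> set_pmf (p_Q (c' j))"
        using Qrv_joint_pmf[of pS W "c' j"] that(1) by blast
      then show ?thesis
        using c'_alph[of j] set_Q that(2) by auto
    qed
    \<comment> \<open>A code determines both q and j. This gives injectivity of the relabelling for
      fixed j and separation of the mixture components.\<close>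
    have g_eq: "Qrv \<omega> = Qrv \<omega>' \<and> i = j"
      if "g (Qrv \<omega>, i) = g (Qrv \<omega>', j)" "\<omega> \<in> set_pmf (joint_pmf pS W (c' i))"
        "\<omega>' \<in> set_pmf (joint_pmf pS W (c' j))" "i < ?N" "j < ?N" for \<omega> \<omega>' i j
      using inj_onD[OF bij_betw_imp_inj_on[OF g] that(1) Q_in[OF that(2,4)] Q_in[OF that(3,5)]] by simp
    have fin: "finite (set_pmf (joint_pmf pS W (c' j)))" for j
      by (rule finite_set_joint_pmf[OF c'])
    have E: "T (?E j) = (if even j then T (map_pmf view1 (joint_pmf pS W a)) else T (map_pmf view2 (joint_pmf pS W a)))"
      if "j < ?N" for j
    proof -
      have "inj_on (\<lambda>q. g (q, j)) (Qrv ` set_pmf (map_pmf view1 (joint_pmf pS W (c' j))))"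
      proof (rule inj_onI)
        fix q q' assume "q \<in> Qrv ` set_pmf (map_pmf view1 (joint_pmf pS W (c' j)))"
          "q' \<in> Qrv ` set_pmf (map_pmf view1 (joint_pmf pS W (c' j)))" and eq: "g (q, j) = g (q', j)"
        then obtain \<omega> \<omega>' where "\<omega> \<in> set_pmf (joint_pmf pS W (c' j))" "q = Qrv \<omega>"
          "\<omega>' \<in> set_pmf (joint_pmf pS W (c' j))" "q' = Qrv \<omega>'"
          unfolding set_map_pmf image_image view_sel by blast
        then show "q = q'"
          using g_eq[of \<omega> j \<omega>' j] eq \<open>j < ?N\<close> by simp
      qed
      then have "T (?E j) = T (map_pmf view1 (joint_pmf pS W (c' j)))"
        by (intro mi_terms_relabel[OF T]) (simp_all add: fin)
      then show ?thesis
        using mi_terms_joint_exchange_funpow[OF c T, of j] by (simp add: c'_def joint_c)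
    qed
    have Qrv_E: "\<exists>\<eta>\<in>set_pmf (joint_pmf pS W (c' j)). Qrv \<omega> = g (Qrv \<eta>, j)"
      if "\<omega> \<in> set_pmf (?E j)" for \<omega> j
      using that by auto
    have "map_pmf view1 (joint_pmf pS W b) = ?J \<bind> ?E"
      by (simp add: joint_b map_bind_pmf map_pmf_comp view1_relabel)
    moreover have "T (?J \<bind> ?E) = (\<Sum>j<?N. T (?E j)) / card {..<?N}"
    proof (rule mi_terms_mixture[OF T J])
      fix i j \<omega> \<omega>'
      assume ij: "i \<in> {..<?N}" "j \<in> {..<?N}" and \<omega>: "\<omega> \<in> set_pmf (?E i)"
        and \<omega>': "\<omega>' \<in> set_pmf (?E j)" and eq: "Qrv \<omega> = Qrv \<omega>'"
      obtain \<eta> where \<eta>: "\<eta> \<in> set_pmf (joint_pmf pS W (c' i))" "Qrv \<omega> = g (Qrv \<eta>, i)"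
        by (rule bexE[OF Qrv_E[OF \<omega>]])
      obtain \<eta>' where \<eta>': "\<eta>' \<in> set_pmf (joint_pmf pS W (c' j))" "Qrv \<omega>' = g (Qrv \<eta>', j)"
        by (rule bexE[OF Qrv_E[OF \<omega>']])
      show "i = j"
        using g_eq[OF _ \<eta>(1) \<eta>'(1)] \<eta>(2) \<eta>'(2) eq ij by simp
    qed (simp add: fin)
    \<comment> \<open>The \<open>n\<close> even indices contribute the value of receiver 1 and the
      \<open>n\<close> odd ones that of receiver 2.\<close>
    moreover have "(\<Sum>j<?N. T (?E j)) = n * (T (map_pmf view1 (joint_pmf pS W a)) + T (map_pmf view2 (joint_pmf pS W a)))"
      by (simp add: E sum_alternating)
    ultimately have "T (map_pmf view1 (joint_pmf pS W b)) =
        n * (T (map_pmf view1 (joint_pmf pS W a)) + T (map_pmf view2 (joint_pmf pS W a))) / ?N"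
      by simp
    then show ?thesis
      using n(2) by simp
  qed
  with b sym show ?thesis
    by (rule that)
qed

text \<open>Halving the two sum bounds gives the two terms of the objective at the averaged
  quantities, because a minimum is at most the mean and a maximum at least the mean.\<close>

lemma ex_sym_objective_ge:
  assumes "(R, R) \<in> SW_region pS W"
  obtains b where "is_aux b" "symmetric_aux \<pi> b" "R \<le> sym_objective (joint_pmf pS W b)"
proof -
  from assms obtain a where a: "is_aux a" and R: "in_region_for (joint_pmf pS W a) R R"
    by (auto simp: SW_region_def)
  obtain b where b: "is_aux b" "symmetric_aux \<pi> b"
    and avg: "\<And>T. T \<in> mi_terms \<Longrightarrow> T (map_pmf view1 (joint_pmf pS W b)) =
      (T (map_pmf view1 (joint_pmf pS W a)) + T (map_pmf view2 (joint_pmf pS W a))) / 2"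
    by (rule symmetrize[OF a]) blast
  have "R \<le> sym_objective (map_pmf view1 (joint_pmf pS W b))"
    using R unfolding in_region_for_views[OF finite_set_joint_pmf[OF a]] sym_objective_eq
    by (simp add: avg mi_terms_def) argo
  then show ?thesis
    using that b by (simp add: sym_objective_view1 finite_set_joint_pmf)
qed

section \<open>Equality of the two suprema\<close>

lemma R_sym_eq:
  "R_sym pS W = Sup {ereal (sym_objective (joint_pmf pS W a)) | a. is_aux a \<and> symmetric_aux \<pi> a}"
proof (rule antisym)
  show "R_sym pS W \<le> Sup {ereal (sym_objective (joint_pmf pS W a)) | a. is_aux a \<and> symmetric_aux \<pi> a}"
    unfolding R_sym_def
  proof (rule Sup_least, clarify)
    fix R assume "(R, R) \<in> SW_region pS W"
    then obtain b where "is_aux b" "symmetric_aux \<pi> b" "R \<le> sym_objective (joint_pmf pS W b)"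
      by (rule ex_sym_objective_ge)
    then show "ereal R \<le> Sup {ereal (sym_objective (joint_pmf pS W a)) | a. is_aux a \<and> symmetric_aux \<pi> a}"
      by (intro Sup_upper2[of "ereal (sym_objective (joint_pmf pS W b))"]) auto
  qed
  show "Sup {ereal (sym_objective (joint_pmf pS W a)) | a. is_aux a \<and> symmetric_aux \<pi> a} \<le> R_sym pS W"
    by (rule Sup_least) (auto intro: sym_objective_le_R_sym)
qed

end

theorem theorem2:
  fixes pS :: "'s::finite pmf"
    and W :: "'x::finite \<Rightarrow> 's \<Rightarrow> ('y::finite \<times> 'y) pmf"
    and \<pi> :: "'s \<Rightarrow> 's"
  assumes sym: "symmetric_channel pS W \<pi>"
    and mutual: "\<And>x s y. pmf (map_pmf snd (W x s)) y = pmf (map_pmf fst (W x (\<pi> s))) y"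
  shows "R_sym pS W =
    Sup {ereal (sym_objective (joint_pmf pS W a)) | a. is_aux a \<and> symmetric_aux \<pi> a}"
proof -
  interpret exchangeable_channel pS W \<pi>
    using sym mutual by unfold_locales (auto simp: symmetric_channel_def intro: pmf_eqI)
  show ?thesis
    by (rule R_sym_eq)
qed

end
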